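(* Let $n\ge3$. For any $c\in W_{B_n^{(1)}}^0=\mathcal C_{2n}^{s,p}$, we have $$L_{B_n^{(1)}}(c)=L_{D_{n+1}^{(2)}}(c)-a_0^{D_{n+1}^{(2)}}(c)=\frac12\big(L(c)-a_0(c)+a_n(c)\big).$$
   Context: A $2n$-core is a partition having no hook length equal to $2n$; $\mathcal C_{2n}$ is the set of $2n$-cores, $\mathcal C_{2n}^s$ the subset of self-conjugate ones, and $\mathcal C_{2n}^{s,p}$ the subset of $\mathcal C_{2n}^s$ of cores with an even number of boxes on the main diagonal. The box in row $i$, column $j$ has residue $(j-i)\bmod 2n$; boxes of residue $i$ are $i$-nodes. The affine Weyl group $\widetilde{\mathfrak S}_{2n}$ of type $A_{2n-1}^{(1)}$, with simple reflections $s_0,\dots,s_{2n-1}$, acts on $\mathcal C_{2n}$: $s_i\cdot c$ is obtained by removing all removable $i$-nodes of $c$ if there are some, adding all addable $i$-nodes if there are some, and $s_i\cdot c=c$ otherwise. $L(c)$ is the number of boxes of $c$ and $a_i(c)$ the number of boxes of residue $i$. Let $\alpha_0,\dots,\alpha_{2n-1}$, $\Lambda_0,\dots,\Lambda_{2n-1}$ be the simple roots and fundamental weights of type $A_{2n-1}^{(1)}$, with $\widetilde{\mathfrak S}_{2n}$ acting by $s_i(x)=x-\langle x,\alpha_i^\vee\rangle\alpha_i$. Type $D_{n+1}^{(2)}$ is realized by $\alpha_0^{D_{n+1}^{(2)}}=\alpha_0$, $\alpha_i^{D_{n+1}^{(2)}}=\alpha_i+\alpha_{2n-i}$ ($1\le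 i\le n-1$), $\alpha_n^{D_{n+1}^{(2)}}=\alpha_n$, $\Lambda_0^{D_{n+1}^{(2)}}=\Lambda_0$, with Weyl group generated by $s_0$, $s_is_{2n-i}$ ($1\le i\le n-1$), $s_n$. Type $B_n^{(1)}$ is realized by $\alpha_i^{B_n^{(1)}}=\alpha_i^{D_{n+1}^{(2)}}$ ($1\le i\le n$), $\alpha_0^{B_n^{(1)}}=2\alpha_0^{D_{n+1}^{(2)}}+\alpha_1^{D_{n+1}^{(2)}}$, $\Lambda_0^{B_n^{(1)}}=\Lambda_0^{D_{n+1}^{(2)}}$, with Weyl group $W_{B_n^{(1)}}$ generated by $s_0s_1s_{2n-1}s_0$, $s_is_{2n-i}$ ($1\le i\le n-1$), $s_n$. The affine Grassmannian (minimal length representatives of left cosets modulo the finite Weyl group generated by the generators of index $1,\dots,n$) of type $D_{n+1}^{(2)}$, resp. $B_n^{(1)}$, is identified with $\mathcal C_{2n}^s$, resp. $\mathcal C_{2n}^{s,p}$, via $w\mapsto w\cdot\varnothing$. For $X$ either of these two types and $w$ in its Weyl group with $c=w\cdot\varnothing$, write $\Lambda_0^X-w(\Lambda_0^X)=\sum_{i=0}^n a_i^X(c)\alpha_i^X$ (this depends only on $c$); the atomic length is $L_X(c)=\sum_{i=0}^n a_i^X(c)$. *)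

theory Defs
  imports Complex_Main "HOL-Library.Function_Algebras"
    "HOL-Algebra.Bij" "HOL-Algebra.Generated_Groups"
begin

section \<open>Partitions and cores\<close>

text \<open>A partition is identified with its Young diagram, a set of boxes (row, column).
  Rows and columns are numbered from 0; this does not change the residue.\<close>

type_synonym box = "nat \<times> nat"
type_synonym diagram = "box set"

definition is_partition :: "diagram \<Rightarrow> bool" where
  "is_partition c \<longleftrightarrow> finite c \<and>
     (\<forall>i j i' j'. (i, j) \<in> c \<longrightarrow> i' \<le> i \<longrightarrow> j' \<le> j \<longrightarrow> (i', j') \<in> c)"

definition hook :: "diagram \<Rightarrow> box \<Rightarrow> box set" where
  "hook c b = {(i, j) \<in> c. (i = fst b \<and> snd b \<le> j) \<or> (j = snd b \<and> fst b \<le> i)}"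

definition hook_length :: "diagram \<Rightarrow> box \<Rightarrow> nat" where
  "hook_length c b = card (hook c b)"

definition cores :: "nat \<Rightarrow> diagram set" where
  "cores m = {c. is_partition c \<and> (\<forall>b\<in>c. hook_length c b \<noteq> m)}"

definition conjugate :: "diagram \<Rightarrow> diagram" where
  "conjugate c = {(j, i) | i j. (i, j) \<in> c}"

definition self_conj_cores :: "nat \<Rightarrow> diagram set" where
  "self_conj_cores m = {c \<in> cores m. conjugate c = c}"

definition even_self_conj_cores :: "nat \<Rightarrow> diagram set" where
  "even_self_conj_cores m = {c \<in> self_conj_cores m. even (card {b \<in> c. fst b = snd b})}"

definition residue :: "nat \<Rightarrow> box \<Rightarrow> nat" where
  "residue m b = nat ((int (snd b) - int (fst b)) mod int m)"

definition num_boxes :: "diagram \<Rightarrow> nat" where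
  "num_boxes c = card c"

definition num_nodes :: "nat \<Rightarrow> diagram \<Rightarrow> nat \<Rightarrow> nat" where
  "num_nodes m c i = card {b \<in> c. residue m b = i}"

definition removable :: "nat \<Rightarrow> nat \<Rightarrow> diagram \<Rightarrow> box set" where
  "removable m i c = {b. b \<in> c \<and> is_partition (c - {b}) \<and> residue m b = i}"

definition addable :: "nat \<Rightarrow> nat \<Rightarrow> diagram \<Rightarrow> box set" where
  "addable m i c = {b. b \<notin> c \<and> is_partition (insert b c) \<and> residue m b = i}"

definition core_refl :: "nat \<Rightarrow> nat \<Rightarrow> diagram \<Rightarrow> diagram" where
  "core_refl m i c =
     (if removable m i c \<noteq> {} then c - removable m i c
      else if addable m i c \<noteq> {} then c \<union> addable m i c
      else c)"


section \<open>Weights and affine Weyl group of type A, rank m\<close>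

text \<open>Weights are written in the basis consisting of the fundamental weights and the null
  root \<open>\<delta>\<close>, so the coefficient at \<open>Fund i\<close> is the pairing with the \<open>i\<close>-th simple coroot.
  For a given \<open>m\<close> only \<open>Fund i\<close> with \<open>i < m\<close> and \<open>Null\<close> are relevant;
  the reflections below fix all the other coordinates.\<close>

datatype coord = Fund nat | Null

type_synonym weight = "coord \<Rightarrow> real"

definition scale :: "real \<Rightarrow> weight \<Rightarrow> weight" (infixr "*\<^sub>w" 75) where
  "r *\<^sub>w x = (\<lambda>b. r * x b)"

definition null_root :: weight where
  "null_root = (\<lambda>b. if b = Null then 1 else 0)"

definition fund :: "nat \<Rightarrow> weight" where
  "fund i = (\<lambda>b. if b = Fund i then 1 else 0)"

definition coroot_pairing :: "weight \<Rightarrow> nat \<Rightarrow> real" where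
  "coroot_pairing x i = x (Fund i)"

text \<open>The coefficients at the fundamental weights are the entries of the Cartan matrix
  (\<open>m \<ge> 3\<close>); the summand \<open>\<delta>\<close> in \<open>\<alpha>\<^sub>0\<close> makes the sum of all the simple roots equal to
  \<open>\<delta>\<close>, and hence the simple roots linearly independent.\<close>

definition simple_root :: "nat \<Rightarrow> nat \<Rightarrow> weight" where
  "simple_root m i =
     2 *\<^sub>w fund i - fund ((i + 1) mod m) - fund ((i + m - 1) mod m)
       + (if i = 0 then null_root else 0)"

definition weight_refl :: "nat \<Rightarrow> nat \<Rightarrow> weight \<Rightarrow> weight" where
  "weight_refl m i x = x - coroot_pairing x i *\<^sub>w simple_root m i"

text \<open>The Weyl group is realized, faithfully, as a group of linear maps on weights.\<close>

definition weyl_A :: "nat \<Rightarrow> (weight \<Rightarrow> weight) set" where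
  "weyl_A m = generate (BijGroup UNIV) {weight_refl m i | i. i < m}"

text \<open>Graph of the action of \<open>weyl_A m\<close> on cores: \<open>weyl_acts m w c d\<close> means \<open>w \<cdot> c = d\<close>.
  Since the simple reflections are involutions, their products exhaust the group.\<close>

inductive weyl_acts :: "nat \<Rightarrow> (weight \<Rightarrow> weight) \<Rightarrow> diagram \<Rightarrow> diagram \<Rightarrow> bool" for m where
  one: "weyl_acts m id c c"
| refl: "weyl_acts m w c d \<Longrightarrow> i < m \<Longrightarrow>
    weyl_acts m (weight_refl m i \<circ> w) c (core_refl m i d)"


section \<open>Twisted type D, rank n + 1, and untwisted type B, rank n, inside type A, rank 2n\<close>

definition root_D :: "nat \<Rightarrow> nat \<Rightarrow> weight" where
  "root_D n i =
     (if i = 0 \<or> i = n then simple_root (2 * n) i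
      else simple_root (2 * n) i + simple_root (2 * n) (2 * n - i))"

definition root_B :: "nat \<Rightarrow> nat \<Rightarrow> weight" where
  "root_B n i = (if i = 0 then 2 *\<^sub>w root_D n 0 + root_D n 1 else root_D n i)"

definition fund0_D :: weight where
  "fund0_D = fund 0"

definition fund0_B :: weight where
  "fund0_B = fund0_D"

definition weyl_D :: "nat \<Rightarrow> (weight \<Rightarrow> weight) set" where
  "weyl_D n = generate (BijGroup UNIV)
     ({weight_refl (2 * n) 0, weight_refl (2 * n) n} \<union>
      {weight_refl (2 * n) i \<circ> weight_refl (2 * n) (2 * n - i) | i. 1 \<le> i \<and> i \<le> n - 1})"

definition weyl_B :: "nat \<Rightarrow> (weight \<Rightarrow> weight) set" where
  "weyl_B n = generate (BijGroup UNIV)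
     ({weight_refl (2 * n) 0 \<circ> weight_refl (2 * n) 1 \<circ>
         weight_refl (2 * n) (2 * n - 1) \<circ> weight_refl (2 * n) 0,
       weight_refl (2 * n) n} \<union>
      {weight_refl (2 * n) i \<circ> weight_refl (2 * n) (2 * n - i) | i. 1 \<le> i \<and> i \<le> n - 1})"

text \<open>The coefficients of \<open>\<Lambda> - w(\<Lambda>)\<close> in the simple roots, for \<open>w \<in> W\<close> with \<open>w \<cdot> \<emptyset> = c\<close>.
  The description is definite precisely when such a \<open>w\<close> and an expansion exist and the
  expansion is unique and independent of \<open>w\<close>. Coefficients of index above \<open>n\<close> are set to 0.\<close>

definition root_coeffs ::
  "nat \<Rightarrow> (weight \<Rightarrow> weight) set \<Rightarrow> weight \<Rightarrow> (nat \<Rightarrow> weight) \<Rightarrow> diagram \<Rightarrow> nat \<Rightarrow> real" where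
  "root_coeffs n W \<Lambda> \<alpha> c =
     (THE a. (\<forall>i>n. a i = 0) \<and>
        (\<exists>w\<in>W. weyl_acts (2 * n) w {} c \<and> \<Lambda> - w \<Lambda> = (\<Sum>i\<le>n. a i *\<^sub>w \<alpha> i)))"

definition coeff_D :: "nat \<Rightarrow> diagram \<Rightarrow> nat \<Rightarrow> real" where
  "coeff_D n = root_coeffs n (weyl_D n) fund0_D (root_D n)"

definition coeff_B :: "nat \<Rightarrow> diagram \<Rightarrow> nat \<Rightarrow> real" where
  "coeff_B n = root_coeffs n (weyl_B n) fund0_B (root_B n)"

definition atomic_length_D :: "nat \<Rightarrow> diagram \<Rightarrow> real" where
  "atomic_length_D n c = (\<Sum>i\<le>n. coeff_D n c i)"

definition atomic_length_B :: "nat \<Rightarrow> diagram \<Rightarrow> real" where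
  "atomic_length_B n c = (\<Sum>i\<le>n. coeff_B n c i)"

end

theory Submission
  imports Defs
begin

text \<open>
  The conceptual content is that \<open>\<Lambda>\<^sub>0 - w(\<Lambda>\<^sub>0) = \<Sum> a\<^sub>j(c) \<alpha>\<^sub>j\<close> in type \<open>A\<close> whenever \<open>w \<cdot> \<emptyset> = c\<close>, where
  \<open>a\<^sub>j(c)\<close> is the number of boxes of residue \<open>j\<close> (lemma \<open>weyl_acts_fund0\<close>). For a self-conjugate core
  these numbers satisfy \<open>a\<^sub>j = a\<^bsub>2n-j\<^esub>\<close>, so the sum is already an expansion in the roots of type \<open>D\<close>,
  with coefficients \<open>a\<^sub>0, \<dots>, a\<^sub>n\<close>. Since the root of index 0 of type \<open>B\<close> is \<open>2 \<alpha>\<^sub>0 + \<alpha>\<^sub>1\<close> in terms of type \<open>D\<close>, this gives the expansion of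
  type \<open>B\<close> with coefficients \<open>a\<^sub>0 / 2\<close>, \<open>a\<^sub>1 - a\<^sub>0 / 2\<close>, \<open>a\<^sub>2, \<dots>, a\<^sub>n\<close>. Both expansions are unique, as the
  roots are linearly independent. The total of the second one is \<open>a\<^sub>1 + \<dots> + a\<^sub>n\<close>, which is the total of
  the first one without \<open>a\<^sub>0\<close>; and it is half of \<open>L - a\<^sub>0 + a\<^sub>n\<close>, because
  \<open>L = a\<^sub>0 + 2 (a\<^sub>1 + \<dots> + a\<^bsub>n-1\<^esub>) + a\<^sub>n\<close>.

  Two facts about the action on cores have to be supplied. Both are read off from the boundary path
  of a partition, encoded by the row \<open>depth c y\<close> in which it crosses the line of content \<open>y\<close>. For a
  core, a simple reflection adds to this function its second difference at all \<open>y\<close> of the given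
  residue (lemma \<open>depth_core_refl\<close>), in the same way as it acts on the coefficients of a weight. Summing
  over a residue class gives the formula for \<open>w(\<Lambda>\<^sub>0)\<close>.

  The second fact is that every self-conjugate core with an even diagonal is \<open>w \<cdot> \<emptyset>\<close> for an element \<open>w\<close>
  of the Weyl group of type \<open>B\<close>. Stripping off removable boxes of opposite residues expresses
  any self-conjugate core by a word in the generators of type \<open>D\<close>. Among these generators, only \<open>s\<^sub>0\<close>
  changes the parity of the number of diagonal boxes, so an even diagonal means an even number of
  letters \<open>s\<^sub>0\<close>; and such words represent elements of type \<open>B\<close>, because conjugating the other
  generators by \<open>s\<^sub>0\<close> gives elements of type \<open>B\<close> (lemmas \<open>weyl_B_conj_s0\<close> and
  \<open>self_conjugate_core_reachable\<close>).
\<close>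

section \<open>The boundary path of a partition\<close>

text \<open>The part of the line of content \<open>y\<close> that lies on the diagram side of the boundary
  path, a line being parametrized by its row \<open>p \<ge> 0\<close>. The half plane of negative columns is
  counted as part of the diagram, so that the boundary path of a partition meets every line of
  content \<open>y \<in> \<int>\<close> exactly once.\<close>

definition above :: "diagram \<Rightarrow> int \<Rightarrow> nat \<Rightarrow> bool" where
  "above c y p \<longleftrightarrow> int p + y < 0 \<or> (p, nat (int p + y)) \<in> c"

definition depth :: "diagram \<Rightarrow> int \<Rightarrow> nat" where
  "depth c y = card {p. above c y p}"

lemma partition_closed:
  "is_partition c \<Longrightarrow> (i, j) \<in> c \<Longrightarrow> i' \<le> i \<Longrightarrow> j' \<le> j \<Longrightarrow> (i', j') \<in> c"
  unfolding is_partition_def by blast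

lemma finite_above:
  assumes "finite c"
  shows "finite {p. above c y p}"
proof -
  have "{p. above c y p} \<subseteq> {..<nat (- y)} \<union> fst ` c"
    unfolding above_def by force
  then show ?thesis
    using assms by (meson finite_Un finite_imageI finite_lessThan finite_subset)
qed

lemma above_mono:
  assumes "is_partition c" "above c y p" "p' \<le> p"
  shows "above c y p'"
  using assms unfolding above_def by (auto intro: partition_closed)

text \<open>A partition has no gaps along a line, so the number \<open>depth c y\<close> of rows is also the row
  in which the boundary path crosses the line.\<close>

lemma above_iff_depth:
  assumes c: "is_partition c"
  shows "above c y p \<longleftrightarrow> p < depth c y"
proof -
  have fin: "finite {p. above c y p}"
    using c by (simp add: finite_above is_partition_def)
  obtain p0 where "\<not> above c y p0"
    using ex_new_if_finite[OF infinite_UNIV_nat fin] by auto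
  define k where "k = (LEAST p. \<not> above c y p)"
  have k: "\<not> above c y k"
    unfolding k_def using \<open>\<not> above c y p0\<close> by (rule LeastI)
  have "above c y p \<longleftrightarrow> p < k" for p
    using k above_mono[OF c] not_less_Least[of p "\<lambda>p. \<not> above c y p"]
    unfolding k_def[symmetric] by (meson not_le)
  then have "{p. above c y p} = {..<k}" by auto
  then show ?thesis
    unfolding depth_def by auto
qed

text \<open>A partition is determined by its depth function; equalities between partitions are proved
  in this way below.\<close>

lemma mem_iff_depth:
  assumes "is_partition c"
  shows "(p, q) \<in> c \<longleftrightarrow> p < depth c (int q - int p)"
  using above_iff_depth[OF assms, of "int q - int p" p] by (simp add: above_def)

lemma partition_eq_iff_depth:
  assumes "is_partition c" "is_partition d"
  shows "c = d \<longleftrightarrow> (\<forall>y. depth c y = depth d y)"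
proof
  assume "\<forall>y. depth c y = depth d y"
  then have "b \<in> c \<longleftrightarrow> b \<in> d" for b
    using mem_iff_depth[OF assms(1), of "fst b" "snd b"] mem_iff_depth[OF assms(2), of "fst b" "snd b"]
    by simp
  then show "c = d" by blast
qed simp

text \<open>Up to a shift, the Maya diagram: \<open>edge c y\<close> is \<open>1\<close> if the boundary path takes a vertical
  step between the lines \<open>y - 1\<close> and \<open>y\<close>, and \<open>0\<close> if the step is horizontal. With rows
  numbered from 0, the value is \<open>1\<close> exactly at the positions \<open>\<lambda>\<^sub>r - r\<close>.\<close>

definition edge :: "diagram \<Rightarrow> int \<Rightarrow> int" where
  "edge c y = int (depth c (y - 1)) - int (depth c y)"

lemma edge_cases:
  assumes c: "is_partition c"
  shows "edge c y = 0 \<or> edge c y = 1"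
proof -
  have "p < depth c y \<Longrightarrow> p < depth c (y - 1)" for p
    unfolding above_iff_depth[OF c, symmetric] above_def
    by (auto intro: partition_closed[OF c])
  moreover have "Suc p < depth c (y - 1) \<Longrightarrow> p < depth c y" for p
    unfolding above_iff_depth[OF c, symmetric] above_def
    by (auto intro: partition_closed[OF c])
  ultimately have "depth c y \<le> depth c (y - 1)" "depth c (y - 1) \<le> Suc (depth c y)"
    by (meson linorder_not_less order_less_irrefl)+
  then show ?thesis
    unfolding edge_def by linarith
qed

section \<open>Cores as flush abaci\<close>

text \<open>On each runner of the abacus with \<open>m\<close> runners the beads (the \<open>y\<close> with
  \<open>edge c y = 1\<close>) are pushed all the way down: James's description of the \<open>m\<close>-cores. Unlike
  the condition on hooks, it is visibly preserved by the simple reflections.\<close>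

definition abacus_flush :: "nat \<Rightarrow> diagram \<Rightarrow> bool" where
  "abacus_flush m c \<longleftrightarrow> (\<forall>y. edge c y \<le> edge c (y - int m))"

lemma depth_empty: "depth {} y = nat (- y)"
proof -
  have "{p. above {} y p} = {..<nat (- y)}"
    unfolding above_def by auto
  then show ?thesis
    unfolding depth_def by simp
qed

lemma partition_empty: "is_partition {}"
  unfolding is_partition_def by simp

lemma flush_empty: "abacus_flush m {}"
  unfolding abacus_flush_def edge_def depth_empty by auto

text \<open>A vertical step is the end of a row.\<close>

lemma row_end:
  assumes c: "is_partition c" and e: "edge c y = 1"
  obtains q where "int q = int (depth c y) + y" "\<And>j. (depth c y, j) \<in> c \<longleftrightarrow> j < q"
proof -
  let ?r = "depth c y"
  have out: "\<not> above c y ?r" and inn: "above c (y - 1) ?r"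
    using e unfolding above_iff_depth[OF c] edge_def by auto
  define q where "q = nat (int ?r + y)"
  have q: "int q = int ?r + y" "(?r, q) \<notin> c"
    using out unfolding q_def above_def by auto
  have "(?r, j) \<in> c" if "j < q" for j
  proof -
    have "nat (int ?r + (y - 1)) = q - 1" using q(1) that by linarith
    then have "(?r, q - 1) \<in> c" using inn q(1) that unfolding above_def by auto
    then show ?thesis using that by (auto intro: partition_closed[OF c])
  qed
  moreover have "j < q" if "(?r, j) \<in> c" for j
    using q(2) that partition_closed[OF c, of ?r j ?r q] by force
  ultimately show ?thesis using that q(1) by blast
qed

text \<open>A horizontal step is the foot of a column.\<close>

lemma column_end:
  assumes c: "is_partition c" and e: "edge c y = 0"
  obtains s where "int s + 1 = int (depth c y) + y" "\<And>i. (i, s) \<in> c \<longleftrightarrow> i < depth c y"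
proof -
  let ?k = "depth c y"
  have out: "\<not> above c (y - 1) ?k"
    using e unfolding above_iff_depth[OF c] edge_def by auto
  define s where "s = nat (int ?k + (y - 1))"
  have s: "int s + 1 = int ?k + y" "(?k, s) \<notin> c"
    using out unfolding s_def above_def by auto
  have "(i, s) \<in> c" if "i < ?k" for i
  proof -
    have "above c y (?k - 1)" using that unfolding above_iff_depth[OF c] by auto
    moreover have "int (?k - 1) + y = int s" using s(1) that by linarith
    ultimately have "(?k - 1, s) \<in> c" unfolding above_def by auto
    then show ?thesis using that by (auto intro: partition_closed[OF c])
  qed
  moreover have "i < ?k" if "(i, s) \<in> c" for i
    using s(2) that partition_closed[OF c, of i s ?k s] by force
  ultimately show ?thesis using that s(1) by blast
qed

text \<open>If \<open>y\<close> carries a bead and \<open>y - m\<close> does not, then \<open>y\<close> is the end of a row \<open>r\<close> and \<open>y - m\<close> the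
  foot of a column \<open>s\<close>, and the hook of the box \<open>(r, s)\<close> runs along the boundary from one to the
  other; its length is the difference \<open>m\<close> of the two positions.\<close>

lemma core_flush:
  assumes "c \<in> cores m"
  shows "abacus_flush m c"
  unfolding abacus_flush_def
proof (rule allI, rule ccontr)
  fix y
  have c: "is_partition c" and hooks: "\<And>b. b \<in> c \<Longrightarrow> hook_length c b \<noteq> m"
    using assms unfolding cores_def by auto
  assume "\<not> edge c y \<le> edge c (y - int m)"
  then have e: "edge c y = 1" "edge c (y - int m) = 0"
    using edge_cases[OF c, of y] edge_cases[OF c, of "y - int m"] by auto
  define r where "r = depth c y"
  define k where "k = depth c (y - int m)"
  obtain q where q: "int q = int r + y" "\<And>j. (r, j) \<in> c \<longleftrightarrow> j < q"
    using row_end[OF c e(1)] unfolding r_def by blast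
  obtain s where s: "int s + 1 = int k + (y - int m)" "\<And>i. (i, s) \<in> c \<longleftrightarrow> i < k"
    using column_end[OF c e(2)] unfolding k_def by blast
  have rs: "(r, s) \<in> c"
    using q(1) s(1) q(2)[of s] s(2)[of r] by linarith
  then have sq: "s < q" and rk: "r < k" using q(2) s(2) by auto
  have "hook c (r, s) = Pair r ` {s..<q} \<union> (\<lambda>i. (i, s)) ` {Suc r..<k}"
  proof -
    have "b \<in> hook c (r, s) \<longleftrightarrow> b \<in> Pair r ` {s..<q} \<union> (\<lambda>i. (i, s)) ` {Suc r..<k}" for b
    proof (cases b)
      case (Pair i j)
      have "b \<in> hook c (r, s) \<longleftrightarrow> (i = r \<and> s \<le> j \<and> j < q) \<or> (j = s \<and> r \<le> i \<and> i < k)"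
        using q(2)[of j] s(2)[of i] unfolding Pair hook_def by auto
      also have "\<dots> \<longleftrightarrow> (i = r \<and> s \<le> j \<and> j < q) \<or> (j = s \<and> Suc r \<le> i \<and> i < k)"
        using sq by (auto simp: Suc_le_eq order_less_le)
      finally show ?thesis unfolding Pair by auto
    qed
    then show ?thesis by blast
  qed
  moreover have "card (Pair r ` {s..<q} \<union> (\<lambda>i. (i, s)) ` {Suc r..<k}) = (q - s) + (k - Suc r)"
    by (subst card_Un_disjoint) (auto simp: card_image inj_on_def)
  ultimately have "hook_length c (r, s) = (q - s) + (k - Suc r)"
    unfolding hook_length_def by simp
  also have "\<dots> = m" using q(1) s(1) sq rk by linarith
  finally show False using hooks[OF rs] by simp
qed

section \<open>Simple reflections on cores\<close>

lemma partition_insert_iff: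
  assumes c: "is_partition c"
  shows "is_partition (insert (p, q) c) \<longleftrightarrow>
    (p = 0 \<or> (p - 1, q) \<in> insert (p, q) c) \<and> (q = 0 \<or> (p, q - 1) \<in> insert (p, q) c)"
    (is "?L \<longleftrightarrow> ?R")
proof
  assume L: ?L
  then show ?R using partition_closed[OF L, of p q "p - 1" q] partition_closed[OF L, of p q p "q - 1"]
    by auto
next
  assume R: ?R
  have "(i', j') \<in> insert (p, q) c" if "(i, j) \<in> insert (p, q) c" "i' \<le> i" "j' \<le> j" for i j i' j'
  proof (cases "(i, j) \<in> c")
    case True
    then show ?thesis using that partition_closed[OF c] by blast
  next
    case False
    then have ij: "i = p" "j = q" using that by auto
    have "i' \<le> p" "j' \<le> q" using that(2,3) ij by auto
    then consider (corner) "i' = p" "j' = q" | (above) "i' < p" | (left) "j' < q" by linarith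
    then show ?thesis
    proof cases
      case above
      then have "(p - 1, q) \<in> c" using R by auto
      then show ?thesis using above that ij partition_closed[OF c, of "p - 1" q i' j'] by auto
    next
      case left
      then have "(p, q - 1) \<in> c" using R by auto
      then show ?thesis using left that ij partition_closed[OF c, of p "q - 1" i' j'] by auto
    qed auto
  qed
  moreover have "finite (insert (p, q) c)" using c unfolding is_partition_def by simp
  ultimately show ?L unfolding is_partition_def by blast
qed

lemma partition_remove_iff:
  assumes c: "is_partition c"
  shows "is_partition (c - {(p, q)}) \<longleftrightarrow> (p, q) \<notin> c \<or> (Suc p, q) \<notin> c \<and> (p, Suc q) \<notin> c"
    (is "?L \<longleftrightarrow> ?R")
proof
  assume L: ?L
  then show ?R using partition_closed[OF L, of "Suc p" q p q] partition_closed[OF L, of p "Suc q" p q]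
    by auto
next
  assume R: ?R
  have "(i', j') \<in> c - {(p, q)}" if "(i, j) \<in> c - {(p, q)}" "i' \<le> i" "j' \<le> j" for i j i' j'
  proof -
    have "(i', j') \<in> c" using that partition_closed[OF c] by blast
    moreover have "(i', j') \<noteq> (p, q)"
    proof
      assume eq: "(i', j') = (p, q)"
      then have "Suc p \<le> i \<or> Suc q \<le> j" using that by auto
      then have "(Suc p, q) \<in> c \<or> (p, Suc q) \<in> c"
        using that eq partition_closed[OF c, of i j] by auto
      then show False using R eq \<open>(i', j') \<in> c\<close> by auto
    qed
    ultimately show ?thesis by simp
  qed
  moreover have "finite (c - {(p, q)})" using c unfolding is_partition_def by simp
  ultimately show ?L unfolding is_partition_def by blast
qed

lemma residue_eq_iff:
  assumes "0 < m"
  shows "residue m (p, q) = i \<longleftrightarrow> (int q - int p) mod int m = int i"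
proof -
  have "0 \<le> (int q - int p) mod int m" using assms by simp
  then show ?thesis unfolding residue_def fst_conv snd_conv by linarith
qed

text \<open>Addable boxes sit where the boundary makes a concave turn (vertical step, then horizontal
  step), removable boxes where it makes the opposite turn. There is at most one turn on each line.\<close>

lemma addable_iff:
  assumes c: "is_partition c" and m: "0 < m" and y: "int q = int p + y"
  shows "(p, q) \<in> addable m i c \<longleftrightarrow>
    y mod int m = int i \<and> p = depth c y \<and> edge c y = 1 \<and> edge c (y + 1) = 0"
proof -
  have mem: "(p, q) \<in> c \<longleftrightarrow> p < depth c y"
    using mem_iff_depth[OF c, of p q] y by simp
  have left: "q = 0 \<or> (p, q - 1) \<in> c \<longleftrightarrow> p < depth c (y - 1)"
  proof (cases q)
    case 0
    then show ?thesis using y unfolding above_iff_depth[OF c, symmetric] above_def by simp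
  next
    case (Suc q')
    then have "y - 1 = int q' - int p" using y by simp
    then have "p < depth c (y - 1) \<longleftrightarrow> (p, q') \<in> c"
      using mem_iff_depth[OF c, of p q'] by simp
    then show ?thesis using Suc by simp
  qed
  have up: "p = 0 \<or> (p - 1, q) \<in> c \<longleftrightarrow> p \<le> depth c (y + 1)"
  proof (cases p)
    case (Suc p')
    have "p' < depth c (y + 1) \<longleftrightarrow> (p', q) \<in> c"
      using mem_iff_depth[OF c, of p' q] y Suc by (simp add: algebra_simps)
    then show ?thesis using Suc by auto
  qed simp
  have "(p, q) \<in> addable m i c \<longleftrightarrow> y mod int m = int i \<and> (p, q) \<notin> c
      \<and> (q = 0 \<or> (p, q - 1) \<in> c) \<and> (p = 0 \<or> (p - 1, q) \<in> c)"
    unfolding addable_def mem_Collect_eq partition_insert_iff[OF c] residue_eq_iff[OF m]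
    using y by auto
  also have "\<dots> \<longleftrightarrow> y mod int m = int i \<and> p = depth c y \<and> edge c y = 1 \<and> edge c (y + 1) = 0"
    unfolding mem left up
    using edge_cases[OF c, of y] edge_cases[OF c, of "y + 1"] by (auto simp: edge_def)
  finally show ?thesis .
qed

lemma removable_iff:
  assumes c: "is_partition c" and m: "0 < m" and y: "int q = int p + y"
  shows "(p, q) \<in> removable m i c \<longleftrightarrow>
    y mod int m = int i \<and> Suc p = depth c y \<and> edge c y = 0 \<and> edge c (y + 1) = 1"
proof -
  have mem: "(p, q) \<in> c \<longleftrightarrow> p < depth c y"
    using mem_iff_depth[OF c, of p q] y by simp
  have right: "(p, Suc q) \<in> c \<longleftrightarrow> p < depth c (y + 1)"
    using mem_iff_depth[OF c, of p "Suc q"] y by (simp add: algebra_simps)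
  have down: "(Suc p, q) \<in> c \<longleftrightarrow> Suc p < depth c (y - 1)"
    using mem_iff_depth[OF c, of "Suc p" q] y by (simp add: algebra_simps)
  have "(p, q) \<in> removable m i c \<longleftrightarrow> y mod int m = int i \<and> (p, q) \<in> c
      \<and> (p, Suc q) \<notin> c \<and> (Suc p, q) \<notin> c"
    unfolding removable_def mem_Collect_eq partition_remove_iff[OF c] residue_eq_iff[OF m]
    using y by auto
  also have "\<dots> \<longleftrightarrow> y mod int m = int i \<and> Suc p = depth c y \<and> edge c y = 0 \<and> edge c (y + 1) = 1"
    unfolding mem right down
    using edge_cases[OF c, of y] edge_cases[OF c, of "y + 1"] by (auto simp: edge_def)
  finally show ?thesis .
qed

lemma flush_iterate:
  assumes "abacus_flush m c"
  shows "edge c y \<le> edge c (y - int k * int m)"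
proof (induction k)
  case (Suc k)
  have "edge c (y - int k * int m) \<le> edge c (y - int k * int m - int m)"
    using assms unfolding abacus_flush_def by blast
  then show ?case using Suc by (simp add: algebra_simps)
qed simp

lemma flush_congruent:
  assumes fl: "abacus_flush m c" and cong: "x mod int m = y mod int m" and le: "x \<le> y" and m: "0 < m"
  shows "edge c y \<le> edge c x"
proof -
  obtain k where k: "y - x = int m * k"
    using cong by (metis mod_eq_dvd_iff dvd_def)
  have "0 \<le> k" using k le m by (metis diff_ge_0_iff_ge of_nat_0_less_iff zero_le_mult_iff linorder_not_less)
  then have "x = y - int (nat k) * int m" using k by (simp add: algebra_simps)
  then show ?thesis using flush_iterate[OF fl] by metis
qed

text \<open>Positions \<open>x\<close> and \<open>y\<close> of an addable and a removable box of the same residue differ by a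
  multiple of \<open>m\<close>. Flushness fails on the runner of \<open>x\<close> if \<open>y\<close> is the smaller one, and on the
  runner of \<open>x + 1\<close> otherwise.\<close>

lemma not_addable_and_removable:
  assumes c: "is_partition c" and fl: "abacus_flush m c" and m: "0 < m"
  shows "addable m i c = {} \<or> removable m i c = {}"
proof (rule ccontr)
  assume "\<not> ?thesis"
  then obtain p q p' q' where a: "(p, q) \<in> addable m i c" and r: "(p', q') \<in> removable m i c"
    by auto
  define x where "x = int q - int p"
  define y where "y = int q' - int p'"
  have ax: "x mod int m = int i" "edge c x = 1" "edge c (x + 1) = 0"
    using a addable_iff[OF c m, of q p x] by (auto simp: x_def)
  have ry: "y mod int m = int i" "edge c y = 0" "edge c (y + 1) = 1"
    using r removable_iff[OF c m, of q' p' y] by (auto simp: y_def)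
  have "(x + 1) mod int m = (y + 1) mod int m" using ax ry by (metis mod_add_left_eq)
  then show False
    using ax ry flush_congruent[OF fl, of y x] flush_congruent[OF fl, of "x + 1" "y + 1"] m
    by (cases "x \<le> y") auto
qed

text \<open>Removable boxes are maximal in the diagram and addable boxes are minimal in the complement,
  so any set of them can be removed or added simultaneously.\<close>

lemma partition_core_refl:
  assumes c: "is_partition c"
  shows "is_partition (core_refl m i c)"
proof -
  have "is_partition (c - removable m i c)"
    unfolding is_partition_def
  proof (intro conjI allI impI)
    fix p q p' q'
    assume pq: "(p, q) \<in> c - removable m i c" "p' \<le> p" "q' \<le> q"
    then have "(p', q') \<in> c" using partition_closed[OF c] by blast
    moreover have "(p', q') \<notin> removable m i c"
    proof
      assume r: "(p', q') \<in> removable m i c"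
      then have "is_partition (c - {(p', q')})" unfolding removable_def by auto
      moreover have "(p, q) \<in> c - {(p', q')}" using pq r by auto
      ultimately show False using pq partition_closed by blast
    qed
    ultimately show "(p', q') \<in> c - removable m i c" by simp
  qed (use c in \<open>auto simp: is_partition_def\<close>)
  moreover have "is_partition (c \<union> addable m i c)"
    unfolding is_partition_def
  proof (intro conjI allI impI)
    have "addable m i c \<subseteq> {..(Suc (Max (insert 0 (fst ` c))))} \<times> {..(Suc (Max (insert 0 (snd ` c))))}"
    proof
      fix b assume "b \<in> addable m i c"
      then obtain p q where b: "b = (p, q)" "is_partition (insert (p, q) c)"
        by (cases b) (auto simp: addable_def)
      have f: "finite (fst ` c)" "finite (snd ` c)" using c by (auto simp: is_partition_def)
      have "p = 0 \<or> p - 1 \<in> fst ` c" "q = 0 \<or> q - 1 \<in> snd ` c"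
        using b(2) unfolding partition_insert_iff[OF c] by force+
      then have "p - 1 \<le> Max (insert 0 (fst ` c))" "q - 1 \<le> Max (insert 0 (snd ` c))"
        using f by (auto intro: Max_ge)
      then show "b \<in> {..(Suc (Max (insert 0 (fst ` c))))} \<times> {..(Suc (Max (insert 0 (snd ` c))))}"
        using b by auto
    qed
    then have "finite (addable m i c)" by (rule finite_subset) simp
    then show "finite (c \<union> addable m i c)" using c by (simp add: is_partition_def)
  next
    fix p q p' q'
    assume pq: "(p, q) \<in> c \<union> addable m i c" "p' \<le> p" "q' \<le> q"
    then have "(p, q) \<in> c \<or> is_partition (insert (p, q) c)"
      by (auto simp: addable_def)
    then have "(p', q') \<in> insert (p, q) c"
      using pq partition_closed[OF c] partition_closed[of "insert (p, q) c" p q p' q'] by blast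
    then show "(p', q') \<in> c \<union> addable m i c" using pq by blast
  qed
  ultimately show ?thesis unfolding core_refl_def using c by auto
qed

lemma eq_if_same_below:
  fixes a b :: nat
  assumes "\<And>p. p < a \<longleftrightarrow> p < b"
  shows "a = b"
  using assms[of a] assms[of b] by linarith

text \<open>A box is added on the line \<open>y\<close> at a concave turn, removed at a convex turn, and nothing
  happens if the boundary goes straight; in each case \<open>depth\<close> changes by its second difference at
  \<open>y\<close>. Flushness guarantees that turns of only one kind occur on the lines of residue \<open>i\<close>, so that
  \<open>core_refl\<close> treats all of them. In this form the action on cores is linear in the depth function,
  and all its properties below are short calculations.\<close>

lemma depth_core_refl:
  assumes c: "is_partition c" and fl: "abacus_flush m c" and m: "0 < m"
  shows "int (depth (core_refl m i c) y) =
    (if y mod int m = int i then int (depth c (y - 1)) + int (depth c (y + 1)) - int (depth c y)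
     else int (depth c y))"
proof -
  let ?d = "core_refl m i c"
  have d: "is_partition ?d" by (rule partition_core_refl[OF c])
  have second: "int (depth c (y - 1)) + int (depth c (y + 1)) - int (depth c y)
      = int (depth c y) + edge c y - edge c (y + 1)"
    unfolding edge_def by simp
  have exr: "\<exists>p q. int q = int p + y \<and> Suc p = depth c y" 
    if "edge c y = 0" and e: "edge c (y + 1) = 1"
  proof -
    have "depth c y \<noteq> 0" using e by (auto simp: edge_def)
    moreover obtain s where "int s + 1 = int (depth c y) + y" using column_end[OF c \<open>edge c y = 0\<close>] by blast
    ultimately show ?thesis
      by (intro exI[of _ "depth c y - 1"] exI[of _ s]) auto
  qed
  have exa: "\<exists>q. int q = int (depth c y) + y" if "edge c y = 1"
    using row_end[OF c that] by metis
  \<comment> \<open>\<open>R\<close> and \<open>A\<close>: the line carries a removable, respectively an addable, \<open>i\<close>-node.\<close>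
  define R where "R \<longleftrightarrow> y mod int m = int i \<and> edge c y = 0 \<and> edge c (y + 1) = 1"
  define A where "A \<longleftrightarrow> y mod int m = int i \<and> edge c y = 1 \<and> edge c (y + 1) = 0"
  consider (rem) "removable m i c \<noteq> {}" "addable m i c = {}"
    | (add) "removable m i c = {}"
    using not_addable_and_removable[OF c fl m] by blast
  then show ?thesis
  proof cases
    case rem
    then have deq: "?d = c - removable m i c" unfolding core_refl_def by simp
    have nA: "\<not> A"
      using rem(2) exa addable_iff[OF c m, of _ "depth c y" y i] unfolding A_def by blast
    have less: "p < depth ?d y \<longleftrightarrow> p < depth c y \<and> \<not> (R \<and> Suc p = depth c y)" for p
    proof (cases "int p + y < 0")
      case True
      have False if "R" "Suc p = depth c y"
      proof -
        obtain s where "int s + 1 = int (depth c y) + y"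
          using column_end[OF c, of y] \<open>R\<close> unfolding R_def by blast
        then show False using that(2) True by linarith
      qed
      then show ?thesis
        using True unfolding above_iff_depth[OF c, symmetric] above_iff_depth[OF d, symmetric] above_def
        by blast
    next
      case False
      then have q: "int (nat (int p + y)) = int p + y" by simp
      show ?thesis
        using False removable_iff[OF c m q, of i]
        unfolding above_iff_depth[OF c, symmetric] above_iff_depth[OF d, symmetric]
        unfolding above_def deq R_def
        by blast
    qed
    have pos: "0 < depth c y" if R using exr that unfolding R_def by force
    have "p < depth ?d y \<longleftrightarrow> p < (if R then depth c y - 1 else depth c y)" for p
    proof (cases R)
      case True
      with less[of p] pos show ?thesis by (simp only: if_True simp_thms) linarith
    qed (simp add: less)
    then have "depth ?d y = (if R then depth c y - 1 else depth c y)"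
      by (rule eq_if_same_below)
    then have "int (depth ?d y) = int (depth c y) - (if R then 1 else 0)"
      using pos by (cases R) auto
    then show ?thesis
      unfolding second using nA R_def A_def edge_cases[OF c, of y] edge_cases[OF c, of "y + 1"]
      by (cases "y mod int m = int i"; elim disjE) simp_all
  next
    case add
    then have deq: "?d = c \<union> addable m i c" unfolding core_refl_def by auto
    have nR: "\<not> R"
      using add(1) exr removable_iff[OF c m, of _ _ y i] unfolding R_def by blast
    have less: "p < depth ?d y \<longleftrightarrow> p < depth c y \<or> (A \<and> p = depth c y)" for p
    proof (cases "int p + y < 0")
      case True
      then show ?thesis
        unfolding above_iff_depth[OF c, symmetric] above_iff_depth[OF d, symmetric]
        using exa unfolding above_def A_def by force
    next
      case False
      then have q: "int (nat (int p + y)) = int p + y" by simp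
      show ?thesis
        using False addable_iff[OF c m q, of i]
        unfolding above_iff_depth[OF c, symmetric] above_iff_depth[OF d, symmetric]
        unfolding above_def deq A_def
        by blast
    qed
    have "p < depth ?d y \<longleftrightarrow> p < (if A then Suc (depth c y) else depth c y)" for p
      by (cases A) (simp_all add: less less_Suc_eq)
    then have "depth ?d y = (if A then Suc (depth c y) else depth c y)"
      by (rule eq_if_same_below)
    then have "int (depth ?d y) = int (depth c y) + (if A then 1 else 0)"
      by simp
    then show ?thesis
      unfolding second using nR R_def A_def edge_cases[OF c, of y] edge_cases[OF c, of "y + 1"]
      by (cases "y mod int m = int i"; elim disjE) simp_all
  qed
qed

section \<open>Diagonals, residues and conjugation\<close>

definition diag_count :: "diagram \<Rightarrow> int \<Rightarrow> nat" where
  "diag_count c y = card {b \<in> c. int (snd b) - int (fst b) = y}"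

text \<open>The term \<open>max 0 (- y)\<close> is the contribution of the negative columns. Its second difference
  in \<open>y\<close> is concentrated at \<open>y = 0\<close>, which is where the fundamental weight \<open>\<Lambda>\<^sub>0\<close> comes from in the
  count of nodes below.\<close>

lemma depth_eq_diag_count:
  assumes "finite c"
  shows "int (depth c y) = int (diag_count c y) + max 0 (- y)"
proof -
  let ?D = "{b \<in> c. int (snd b) - int (fst b) = y}"
  have "{p. above c y p} = {..<nat (- y)} \<union> fst ` ?D"
  proof -
    have "p \<in> fst ` ?D" if "0 \<le> int p + y" "(p, nat (int p + y)) \<in> c" for p
      using that by (intro image_eqI[of _ _ "(p, nat (int p + y))"]) auto
    then show ?thesis unfolding above_def by force
  qed
  moreover have "card ({..<nat (- y)} \<union> fst ` ?D) = nat (- y) + card (fst ` ?D)"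
    using assms by (subst card_Un_disjoint) auto
  moreover have "card (fst ` ?D) = diag_count c y"
    unfolding diag_count_def by (rule card_image) (auto simp: inj_on_def)
  ultimately show ?thesis unfolding depth_def by simp
qed

lemma num_nodes_eq_sum:
  assumes c: "finite c" and S: "finite S" "\<And>b. b \<in> c \<Longrightarrow> int (snd b) - int (fst b) \<in> S" and m: "0 < m"
  shows "num_nodes m c i = (\<Sum>y\<in>S. if y mod int m = int i then diag_count c y else 0)"
proof -
  have res: "residue m b = i \<longleftrightarrow> (int (snd b) - int (fst b)) mod int m = int i" for b
    using residue_eq_iff[OF m, of "fst b" "snd b" i] by simp
  have "{b \<in> c. residue m b = i}
      = (\<Union>y\<in>{y \<in> S. y mod int m = int i}. {b \<in> c. int (snd b) - int (fst b) = y})"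
    unfolding res using S(2) by blast
  then have "num_nodes m c i = (\<Sum>y\<in>{y \<in> S. y mod int m = int i}. diag_count c y)"
    unfolding num_nodes_def diag_count_def
    using c S(1) by (subst card_UN_disjoint[symmetric]) auto
  then show ?thesis using S(1) by (simp add: sum.inter_filter)
qed

lemma conjugate_iff: "(p, q) \<in> conjugate c \<longleftrightarrow> (q, p) \<in> c"
  unfolding conjugate_def by auto

lemma conjugate_eq_image: "conjugate c = prod.swap ` c"
  unfolding conjugate_def by force

lemma partition_conjugate: "is_partition c \<Longrightarrow> is_partition (conjugate c)"
  unfolding is_partition_def conjugate_iff by (auto simp: conjugate_eq_image)

lemma diag_count_conjugate: "diag_count (conjugate c) y = diag_count c (- y)"
proof -
  have "{b \<in> conjugate c. int (snd b) - int (fst b) = y}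
      = prod.swap ` {b \<in> c. int (snd b) - int (fst b) = - y}"
    unfolding conjugate_eq_image by auto
  then show ?thesis unfolding diag_count_def by (simp add: card_image)
qed

lemma depth_conjugate:
  assumes "is_partition c"
  shows "int (depth (conjugate c) y) = int (depth c (- y)) - y"
  using assms partition_conjugate[OF assms]
  by (simp add: is_partition_def depth_eq_diag_count diag_count_conjugate)

text \<open>Reflecting the diagram reverses the boundary path and exchanges vertical and horizontal steps.\<close>

lemma edge_conjugate:
  assumes "is_partition c"
  shows "edge (conjugate c) y = 1 - edge c (1 - y)"
  unfolding edge_def depth_conjugate[OF assms] by simp

lemma flush_conjugate:
  assumes c: "is_partition c" and fl: "abacus_flush m c"
  shows "abacus_flush m (conjugate c)"
  unfolding abacus_flush_def edge_conjugate[OF c]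
proof
  fix y
  have "edge c (1 - y + int m) \<le> edge c (1 - y + int m - int m)"
    using fl unfolding abacus_flush_def by blast
  then show "1 - edge c (1 - y) \<le> 1 - edge c (1 - (y - int m))"
    by (simp add: algebra_simps)
qed

lemma residue_swap:
  assumes "0 < i" "i < m"
  shows "residue m (q, p) = m - i \<longleftrightarrow> residue m (p, q) = i"
proof -
  have m: "0 < m" using assms by simp
  have "(int q - int p) mod int m = int i \<longleftrightarrow> (- (int q - int p)) mod int m = int m - int i"
    using assms zmod_zminus1_eq_if[of "int q - int p" "int m"] by auto
  then show ?thesis using assms by (simp add: residue_eq_iff[OF m] of_nat_diff)
qed

lemma num_nodes_conjugate:
  assumes "0 < i" "i < m"
  shows "num_nodes m (conjugate c) (m - i) = num_nodes m c i"
proof -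
  have "{b \<in> conjugate c. residue m b = m - i} = prod.swap ` {b \<in> c. residue m b = i}"
    unfolding conjugate_eq_image using residue_swap[OF assms] by auto
  then show ?thesis unfolding num_nodes_def by (simp add: card_image)
qed

section \<open>Relations between the reflections of cores\<close>

lemma mod_shift_neq:
  assumes "2 \<le> (m::nat)" "y mod int m = z mod int m"
  shows "(y + 1) mod int m \<noteq> z mod int m" "(y - 1) mod int m \<noteq> z mod int m"
proof -
  have "\<not> int m dvd 1" using assms(1) by auto
  then show "(y + 1) mod int m \<noteq> z mod int m" "(y - 1) mod int m \<noteq> z mod int m"
    using assms(2) by (metis add_diff_cancel_left' mod_eq_dvd_iff, metis diff_diff_eq2 add_diff_cancel_left' mod_eq_dvd_iff diff_add_cancel)
qed

text \<open>The simple reflection exchanges two adjacent runners of the abacus.\<close>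

lemma edge_core_refl:
  assumes c: "is_partition c" and fl: "abacus_flush m c" and m: "2 \<le> m"
  shows "edge (core_refl m i c) y =
    (if y mod int m = int i then edge c (y + 1)
     else if (y - 1) mod int m = int i then edge c (y - 1)
     else edge c y)"
proof -
  have m0: "0 < m" using m by simp
  have "(y - 1) mod int m \<noteq> int i" if "y mod int m = int i"
    using mod_shift_neq(2)[OF m, of y y] that by simp
  then show ?thesis
    unfolding edge_def depth_core_refl[OF c fl m0] by simp
qed

lemma flush_core_refl:
  assumes c: "is_partition c" and fl: "abacus_flush m c" and m: "2 \<le> m"
  shows "abacus_flush m (core_refl m i c)"
proof -
  have le: "edge c z \<le> edge c (z - int m)" for z
    using fl unfolding abacus_flush_def by blast
  have "(z - int m) mod int m = z mod int m" "(z - int m - 1) mod int m = (z - 1) mod int m" for z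
    by (simp, metis diff_right_commute minus_mod_self2)
  then show ?thesis
    unfolding abacus_flush_def edge_core_refl[OF assms]
    using le le[of "_ + 1"] le[of "_ - 1"] by (simp add: algebra_simps)
qed

lemma core_refl_involution:
  assumes c: "is_partition c" and fl: "abacus_flush m c" and m: "2 \<le> m"
  shows "core_refl m i (core_refl m i c) = c"
proof -
  let ?d = "core_refl m i c"
  have m0: "0 < m" using m by simp
  have d: "is_partition ?d" "abacus_flush m ?d"
    using partition_core_refl[OF c] flush_core_refl[OF assms] by auto
  have "int (depth (core_refl m i ?d) y) = int (depth c y)" for y
  proof (cases "y mod int m = int i")
    case True
    then have "(y - 1) mod int m \<noteq> int i" "(y + 1) mod int m \<noteq> int i"
      using mod_shift_neq[OF m, of y y] by auto
    then show ?thesis using True by (simp add: depth_core_refl[OF d m0] depth_core_refl[OF c fl m0])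
  qed (simp add: depth_core_refl[OF d m0] depth_core_refl[OF c fl m0])
  then show ?thesis
    using partition_eq_iff_depth[OF partition_core_refl[OF d(1)] c] by simp
qed

lemma core_refl_commute:
  assumes c: "is_partition c" and fl: "abacus_flush m c" and m: "2 \<le> m"
    and nadj: "(int i + 1) mod int m \<noteq> int j" "(int i - 1) mod int m \<noteq> int j" "i \<noteq> j"
      "(int j + 1) mod int m \<noteq> int i" "(int j - 1) mod int m \<noteq> int i"
  shows "core_refl m i (core_refl m j c) = core_refl m j (core_refl m i c)"
proof -
  have m0: "0 < m" using m by simp
  have D: "is_partition (core_refl m k c)" "abacus_flush m (core_refl m k c)" for k
    using partition_core_refl[OF c] flush_core_refl[OF c fl m] by auto
  have "int (depth (core_refl m i (core_refl m j c)) y)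
      = int (depth (core_refl m j (core_refl m i c)) y)" for y
  proof -
    have "(y + 1) mod int m = (y mod int m + 1) mod int m" "(y - 1) mod int m = (y mod int m - 1) mod int m"
      by (simp_all add: mod_simps)
    then show ?thesis
      using nadj unfolding depth_core_refl[OF D m0] depth_core_refl[OF c fl m0] by auto
  qed
  then show ?thesis
    using partition_eq_iff_depth[OF partition_core_refl[OF D(1)] partition_core_refl[OF D(1)]] by simp
qed

lemma conjugate_core_refl:
  assumes c: "is_partition c" and fl: "abacus_flush m c" and m: "2 \<le> m"
    and ij: "\<And>y. y mod int m = int i \<longleftrightarrow> (- y) mod int m = int j"
  shows "conjugate (core_refl m i c) = core_refl m j (conjugate c)"
proof -
  have m0: "0 < m" using m by simp
  note c' = partition_conjugate[OF c] flush_conjugate[OF c fl]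
  note d = partition_core_refl[OF c]
  have "int (depth (conjugate (core_refl m i c)) y) = int (depth (core_refl m j (conjugate c)) y)" for y
    using ij[of "- y"] arg_cong[OF minus_diff_commute[of 1 y], of "depth c"]
    by (simp add: depth_conjugate[OF d] depth_core_refl[OF c fl m0] depth_core_refl[OF c' m0]
        depth_conjugate[OF c] algebra_simps)
  then show ?thesis
    using partition_eq_iff_depth[OF partition_conjugate[OF d] partition_core_refl[OF c'(1)]] by simp
qed

lemma diagonal_boxes_eq_depth:
  assumes "finite c"
  shows "card {b \<in> c. fst b = snd b} = depth c 0"
proof -
  have "{b \<in> c. fst b = snd b} = {b \<in> c. int (snd b) - int (fst b) = 0}" by auto
  then show ?thesis using depth_eq_diag_count[OF assms, of 0] by (simp add: diag_count_def)
qed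

text \<open>For a self-conjugate diagram the depths at \<open>-1\<close> and \<open>1\<close> differ by exactly one, hence the new
  number of diagonal boxes and the old one have an odd sum: the boundary always turns on the main
  diagonal.\<close>

lemma diagonal_parity_core_refl_0:
  assumes c: "is_partition c" and fl: "abacus_flush m c" and m: "2 \<le> m" and sc: "conjugate c = c"
  shows "even (depth (core_refl m 0 c) 0) \<longleftrightarrow> odd (depth c 0)"
proof -
  have m0: "0 < m" using m by simp
  have "int (depth c (- 1)) = int (depth c 1) + 1"
    using depth_conjugate[OF c, of "- 1"] sc by simp
  then have "int (depth (core_refl m 0 c) 0) = 2 * int (depth c 1) + 1 - int (depth c 0)"
    using depth_core_refl[OF c fl m0, of 0 0] by simp
  then have "even (int (depth (core_refl m 0 c) 0)) \<longleftrightarrow> odd (int (depth c 0))"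
    by simp
  then show ?thesis by simp
qed

lemma diagonal_core_refl:
  assumes c: "is_partition c" and fl: "abacus_flush m c" and m: "2 \<le> m" and i: "i \<noteq> 0"
  shows "depth (core_refl m i c) 0 = depth c 0"
  using depth_core_refl[OF c fl, of i 0] m i by simp

section \<open>Residue counts and the orbit of the fundamental weight\<close>

lemma num_nodes_core_refl_other:
  assumes c: "is_partition c" and fl: "abacus_flush m c" and m: "2 \<le> m" and ij: "j \<noteq> i"
  shows "num_nodes m (core_refl m i c) j = num_nodes m c j"
proof -
  let ?d = "core_refl m i c"
  have m0: "0 < m" using m by simp
  have fin: "finite c" "finite ?d" using c partition_core_refl[OF c] by (auto simp: is_partition_def)
  define S where "S = (\<lambda>b. int (snd b) - int (fst b)) ` (c \<union> ?d)"
  have S: "finite S" using fin unfolding S_def by simp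
  have "diag_count ?d y = diag_count c y" if "y mod int m = int j" for y
    using depth_core_refl[OF c fl m0, of i y] that ij
      depth_eq_diag_count[OF fin(1), of y] depth_eq_diag_count[OF fin(2), of y] by simp
  then show ?thesis
    using num_nodes_eq_sum[OF fin(1) S _ m0, of j] num_nodes_eq_sum[OF fin(2) S _ m0, of j]
    unfolding S_def by (simp cong: if_cong)
qed

text \<open>Summing the second differences over the lines of residue \<open>i\<close> gives the three neighbouring
  node counts, and the term at \<open>y = 0\<close> remains. The right-hand side is the coefficient of
  \<open>\<alpha>\<^sub>i\<close> in \<open>\<Lambda>\<^sub>0 - s\<^sub>i(\<Lambda>\<^sub>0 - \<Sum> a\<^sub>j \<alpha>\<^sub>j)\<close>.\<close>

lemma num_nodes_core_refl:
  assumes c: "is_partition c" and fl: "abacus_flush m c" and m: "2 \<le> m" and i: "i < m"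
  shows "int (num_nodes m (core_refl m i c) i) = (if i = 0 then 1 else 0)
    + int (num_nodes m c ((i + 1) mod m)) + int (num_nodes m c ((i + m - 1) mod m))
    - int (num_nodes m c i)"
proof -
  let ?d = "core_refl m i c"
  have m0: "0 < m" using m by simp
  have fin: "finite c" "finite ?d" using c partition_core_refl[OF c] by (auto simp: is_partition_def)
  \<comment> \<open>Besides the contents that occur, \<open>S\<close> contains their neighbours, so that it can be shifted
    by one in both directions.\<close>
  define T where "T = insert 0 ((\<lambda>b. int (snd b) - int (fst b)) ` (c \<union> ?d))"
  define S where "S = T \<union> (\<lambda>y. y + 1) ` T \<union> (\<lambda>y. y - 1) ` T"
  have finT: "finite T" using fin unfolding T_def by simp
  then have S: "finite S" unfolding S_def by simp
  have sub: "S \<supseteq> T" "(\<lambda>y. y - 1) ` S \<supseteq> T" "(\<lambda>y. y + 1) ` S \<supseteq> T"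
    unfolding S_def by (auto simp: image_Un image_image)
  have count: "int (num_nodes m e k) = (\<Sum>y\<in>U. if y mod int m = int k then int (diag_count e y) else 0)"
    if "e = c \<or> e = ?d" "finite U" "T \<subseteq> U" for e k U
  proof -
    have "num_nodes m e k = (\<Sum>y\<in>U. if y mod int m = int k then diag_count e y else 0)"
      using that fin by (intro num_nodes_eq_sum) (auto simp: T_def m0)
    then show ?thesis by (simp add: if_distrib[of int] cong: if_cong)
  qed
  have next_mod: "y mod int m = int ((i + 1) mod m) \<longleftrightarrow> (y - 1) mod int m = int i" for y
  proof -
    have "y mod int m = (int i + 1) mod int m \<longleftrightarrow> (y - 1) mod int m = int i mod int m"
      unfolding mod_eq_dvd_iff by (simp add: algebra_simps)
    then show ?thesis using i by (simp add: of_nat_mod add.commute)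
  qed
  have prev_mod: "y mod int m = int ((i + m - 1) mod m) \<longleftrightarrow> (y + 1) mod int m = int i" for y
  proof -
    have "y mod int m = (int i - 1) mod int m \<longleftrightarrow> (y + 1) mod int m = int i mod int m"
      unfolding mod_eq_dvd_iff by (simp add: algebra_simps)
    moreover have "int ((i + m - 1) mod m) = (int i - 1) mod int m"
    proof -
      have "int (i + m - 1) = int i - 1 + int m" using m0 by simp
      then show ?thesis by (simp only: of_nat_mod mod_add_self2)
    qed
    ultimately show ?thesis using i by simp
  qed
  have up: "int (num_nodes m c ((i + 1) mod m))
      = (\<Sum>y\<in>S. if y mod int m = int i then int (diag_count c (y + 1)) else 0)"
    using count[of c "(\<lambda>y. y + 1) ` S" "(i + 1) mod m", unfolded next_mod] S sub
    by (simp add: sum.reindex inj_on_def cong: if_cong)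
  have down: "int (num_nodes m c ((i + m - 1) mod m))
      = (\<Sum>y\<in>S. if y mod int m = int i then int (diag_count c (y - 1)) else 0)"
    using count[of c "(\<lambda>y. y - 1) ` S" "(i + m - 1) mod m", unfolded prev_mod] S sub
    by (simp add: sum.reindex inj_on_def cong: if_cong)
  have zero: "(\<Sum>y\<in>S. if y = 0 then if i = 0 then 1 else 0 else 0) = (if i = 0 then 1 else (0::int))"
    using S unfolding S_def T_def by simp
  have step: "(if y mod int m = int i then int (diag_count ?d y) else 0) =
      (if y = 0 then if i = 0 then 1 else 0 else 0)
      + (if y mod int m = int i then int (diag_count c (y + 1)) else 0)
      + (if y mod int m = int i then int (diag_count c (y - 1)) else 0)
      - (if y mod int m = int i then int (diag_count c y) else 0)" for y
    using depth_core_refl[OF c fl m0, of i y] depth_eq_diag_count[OF fin(2), of y]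
      depth_eq_diag_count[OF fin(1), of y] depth_eq_diag_count[OF fin(1), of "y - 1"]
      depth_eq_diag_count[OF fin(1), of "y + 1"]
    by (cases "y = 0") (auto simp: max_def split: if_splits)
  have "int (num_nodes m ?d i) = (\<Sum>y\<in>S. if y mod int m = int i then int (diag_count ?d y) else 0)"
    using S sub by (intro count) auto
  also have "\<dots> = (if i = 0 then 1 else 0) + int (num_nodes m c ((i + 1) mod m))
      + int (num_nodes m c ((i + m - 1) mod m)) - int (num_nodes m c i)"
    unfolding step sum.distrib sum_subtractf zero up down
    using S sub by (subst count[of c S i]) auto
  finally show ?thesis .
qed

lemma sum_weight_apply: "(\<Sum>i\<in>A. f i) b = (\<Sum>i\<in>A. f i b)" for f :: "'a \<Rightarrow> weight"
  by (induction A rule: infinite_finite_induct) auto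

text \<open>The cyclic discrete Laplacian of the coefficients.\<close>

lemma root_sum_Fund:
  assumes i: "i < m"
  shows "(\<Sum>j<m. y j *\<^sub>w simple_root m j) (Fund i)
    = 2 * y i - y ((i + 1) mod m) - y ((i + m - 1) mod m)"
proof -
  have mods: "(j + 1) mod m = (if j + 1 = m then 0 else j + 1)"
    "(j + m - 1) mod m = (if j = 0 then m - 1 else j - 1)" if "j < m" for j
    using that by (auto simp: mod_if)
  have "(y j *\<^sub>w simple_root m j) (Fund i) = (if j = i then 2 * y j else 0)
      - (if j = (i + m - 1) mod m then y j else 0) - (if j = (i + 1) mod m then y j else 0)"
    if j: "j < m" for j
  proof -
    have "i = (j + 1) mod m \<longleftrightarrow> j = (i + m - 1) mod m"
      "i = (j + m - 1) mod m \<longleftrightarrow> j = (i + 1) mod m"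
      using i j unfolding mods[OF i] mods[OF j] by auto
    then show ?thesis
      by (simp add: scale_def simple_root_def fund_def null_root_def algebra_simps)
  qed
  then have "(\<Sum>j<m. y j *\<^sub>w simple_root m j) (Fund i) = (\<Sum>j<m. (if j = i then 2 * y j else 0)
      - (if j = (i + m - 1) mod m then y j else 0) - (if j = (i + 1) mod m then y j else 0))"
    unfolding sum_weight_apply by simp
  also have "\<dots> = 2 * y i - y ((i + 1) mod m) - y ((i + m - 1) mod m)"
    using i by (simp add: sum_subtractf)
  finally show ?thesis .
qed

lemma root_sum_Null:
  assumes "0 < m"
  shows "(\<Sum>j<m. y j *\<^sub>w simple_root m j) Null = y 0"
proof -
  have "(y j *\<^sub>w simple_root m j) Null = (if j = 0 then y j else 0)" for j
    by (simp add: scale_def simple_root_def fund_def null_root_def)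
  then show ?thesis unfolding sum_weight_apply using assms by simp
qed

text \<open>The coordinate along the null root determines the coefficient of \<open>\<alpha>\<^sub>0\<close>. The Cartan matrix
  equations then force a vector with \<open>x\<^sub>0 = 0\<close> to grow linearly, and the equation that closes the
  cycle makes the slope zero.\<close>

lemma simple_roots_independent:
  assumes m: "0 < m" and eq: "(\<Sum>j<m. y j *\<^sub>w simple_root m j) = (\<Sum>j<m. z j *\<^sub>w simple_root m j)"
    and i: "i < m"
  shows "y i = z i"
proof -
  define x where "x = (\<lambda>i. y i - z i)"
  have x0: "x 0 = 0"
    using fun_cong[OF eq, of Null] root_sum_Null[OF m] by (simp add: x_def)
  have rec: "2 * x i - x ((i + 1) mod m) - x ((i + m - 1) mod m) = 0" if "i < m" for i
    using fun_cong[OF eq, of "Fund i"] root_sum_Fund[OF that] by (simp add: x_def)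
  have lin: "i < m \<Longrightarrow> x i = of_nat i * x (1 mod m)" for i
  proof (induction i rule: less_induct)
    case (less i)
    consider "i = 0" | "i = 1" | k where "i = Suc (Suc k)" by (cases i rule: nat.exhaust) (auto, metis Suc_pred' not_gr_zero One_nat_def)
    then show ?case
    proof cases
      case 3
      have "(Suc k + m - 1) mod m = k" using less.prems 3 by simp
      then show ?thesis using rec[of "Suc k"] less.IH[of k] less.IH[of "Suc k"] less.prems 3
        by (simp add: algebra_simps)
    qed (use less.prems x0 in auto)
  qed
  have "x (1 mod m) = 0"
  proof (cases "m = 1")
    case False
    then have *: "m - 1 < m" "m - 1 + 1 = m" "(m - 1 + m - 1) mod m = m - 2" "1 mod m = 1"
      using m by (auto simp: mod_if)
    have "2 * (real (m - 1) * x 1) - x 0 - real (m - 2) * x 1 = 0"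
      using rec[OF *(1)] lin[OF *(1)] lin[of "m - 2"] m unfolding * by simp
    then have "real m * x 1 = 0" using x0 m False
      by (cases "m = 0") (simp_all add: of_nat_diff algebra_simps)
    then show ?thesis using m * by simp
  qed (use x0 in simp)
  then show ?thesis using lin[OF i] by (simp add: x_def)
qed

text \<open>The link between cores and weights: applying a simple reflection to the weight
  \<open>\<Lambda>\<^sub>0 - \<Sum> a\<^sub>j(c) \<alpha>\<^sub>j\<close> changes the coefficients exactly as the reflection of the core changes the
  residue counts. In particular \<open>w(\<Lambda>\<^sub>0)\<close> depends on \<open>w \<cdot> \<emptyset>\<close> alone.\<close>

lemma weyl_acts_fund0:
  assumes "weyl_acts m w {} c" and m: "2 \<le> m"
  shows "is_partition c \<and> abacus_flush m c \<and>
    fund 0 - w (fund 0) = (\<Sum>j<m. real (num_nodes m c j) *\<^sub>w simple_root m j)"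
  using assms(1)
proof (induction w "{} :: diagram" c rule: weyl_acts.induct)
  case one
  then show ?case
    by (simp add: partition_empty flush_empty num_nodes_def scale_def fun_eq_iff sum_weight_apply)
next
  case (refl w d i)
  let ?a = "\<lambda>e j. real (num_nodes m e j)"
  let ?e = "core_refl m i d"
  have d: "is_partition d" "abacus_flush m d"
    and IH: "fund 0 - w (fund 0) = (\<Sum>j<m. ?a d j *\<^sub>w simple_root m j)"
    using refl.hyps by blast+
  define p where "p = coroot_pairing (w (fund 0)) i"
  have "w (fund 0) = fund 0 - (\<Sum>j<m. ?a d j *\<^sub>w simple_root m j)"
    unfolding IH[symmetric] by simp
  then have "p = (if i = 0 then 1 else 0) - (\<Sum>j<m. ?a d j *\<^sub>w simple_root m j) (Fund i)"
    unfolding p_def coroot_pairing_def by (simp add: fund_def)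
  then have p: "?a ?e i = ?a d i + p"
    unfolding root_sum_Fund[OF \<open>i < m\<close>]
    using num_nodes_core_refl[OF d m \<open>i < m\<close>] by (simp add: of_int_eq_iff[symmetric, where 'a=real] split: if_splits)
  have e: "?a ?e j = ?a d j + (if j = i then p else 0)" for j
    using p num_nodes_core_refl_other[OF d m, of j i] by simp
  have "fund 0 - (weight_refl m i \<circ> w) (fund 0)
      = (\<Sum>j<m. ?a d j *\<^sub>w simple_root m j) + p *\<^sub>w simple_root m i"
    unfolding IH[symmetric] by (simp add: weight_refl_def p_def)
  also have "\<dots> = (\<Sum>j<m. ?a ?e j *\<^sub>w simple_root m j)"
  proof -
    have "(\<Sum>j<m. ?a ?e j *\<^sub>w simple_root m j)
        = (\<Sum>j<m. ?a d j *\<^sub>w simple_root m j + (if j = i then p *\<^sub>w simple_root m i else 0))"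
      unfolding e by (intro sum.cong HOL.refl) (auto simp: scale_def fun_eq_iff algebra_simps)
    then show ?thesis using \<open>i < m\<close> by (simp add: sum.distrib)
  qed
  finally show ?case using partition_core_refl[OF d(1)] flush_core_refl[OF d m] by simp
qed

section \<open>Elements of the Weyl groups\<close>

lemma simple_root_Fund:
  assumes "3 \<le> m" "i < m"
  shows "simple_root m i (Fund j) =
    (if j = i then 2 else if j = (i + 1) mod m \<or> j = (i + m - 1) mod m then - 1 else 0)"
proof -
  have "(i + 1) mod m = (if i + 1 = m then 0 else i + 1)"
    "(i + m - 1) mod m = (if i = 0 then m - 1 else i - 1)"
    using assms by (auto simp: mod_if)
  then show ?thesis using assms
    by (auto simp: simple_root_def scale_def fund_def null_root_def)
qed

lemma weight_refl_involution:
  assumes "3 \<le> m" "i < m"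
  shows "weight_refl m i \<circ> weight_refl m i = id"
proof
  fix x
  have "coroot_pairing (weight_refl m i x) i = - coroot_pairing x i"
    using simple_root_Fund[OF assms, of i]
    by (simp add: weight_refl_def coroot_pairing_def scale_def)
  then show "(weight_refl m i \<circ> weight_refl m i) x = id x"
    by (simp add: weight_refl_def[of m i "weight_refl m i x"])
      (simp add: weight_refl_def scale_def fun_eq_iff)
qed

lemma weight_refl_commute:
  assumes m: "3 \<le> m" and ij: "i < m" "j < m" "j \<noteq> i" "j \<noteq> (i + 1) mod m" "i \<noteq> (j + 1) mod m"
  shows "weight_refl m i \<circ> weight_refl m j = weight_refl m j \<circ> weight_refl m i"
proof -
  have "simple_root m i (Fund j) = 0" "simple_root m j (Fund i) = 0"
    using ij unfolding simple_root_Fund[OF m ij(1)] simple_root_Fund[OF m ij(2)]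
    by (auto simp: mod_if split: if_splits)
  then show ?thesis
    by (intro ext) (simp add: weight_refl_def coroot_pairing_def scale_def fun_eq_iff)
qed

lemma bij_weight_refl:
  assumes "3 \<le> m" "i < m"
  shows "bij (weight_refl m i)"
  using weight_refl_involution[OF assms] o_bij by blast

lemma generate_comp:
  assumes S: "\<And>h. h \<in> S \<Longrightarrow> bij h"
    and f: "f \<in> generate (BijGroup UNIV) S" and g: "g \<in> generate (BijGroup UNIV) S"
  shows "f \<circ> g \<in> generate (BijGroup UNIV) S"
proof -
  have sub: "S \<subseteq> carrier (BijGroup UNIV)"
    using S by (auto simp: BijGroup_def Bij_def extensional_def)
  have carr: "f \<in> Bij UNIV" "g \<in> Bij UNIV"
    using group.generate_in_carrier[OF group_BijGroup sub f]
      group.generate_in_carrier[OF group_BijGroup sub g] by (simp_all add: BijGroup_def)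
  have "f \<otimes>\<^bsub>BijGroup UNIV\<^esub> g = f \<circ> g"
    using carr by (simp add: BijGroup_def compose_def comp_def restrict_def)
  then show ?thesis using generate.eng[OF f g] by simp
qed

lemma id_in_generate: "id \<in> generate (BijGroup UNIV) S"
proof -
  have "\<one>\<^bsub>BijGroup UNIV\<^esub> = id" by (auto simp: BijGroup_def)
  then show ?thesis using generate.one[of "BijGroup UNIV" S] by metis
qed

lemma weyl_D_comp:
  assumes "3 \<le> n" "f \<in> weyl_D n" "g \<in> weyl_D n"
  shows "f \<circ> g \<in> weyl_D n"
  using assms(2,3) unfolding weyl_D_def
  by (rule generate_comp[rotated]) (use assms(1) in \<open>auto intro!: bij_comp bij_weight_refl\<close>)

lemma weyl_B_comp:
  assumes "3 \<le> n" "f \<in> weyl_B n" "g \<in> weyl_B n"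
  shows "f \<circ> g \<in> weyl_B n"
  using assms(2,3) unfolding weyl_B_def
  by (rule generate_comp[rotated]) (use assms(1) in \<open>auto intro!: bij_comp bij_weight_refl\<close>)

text \<open>\<open>s\<^sub>0\<close> commutes with the generator unless \<open>k = 1\<close>, and for \<open>k = 1\<close> the conjugate is the
  generator of index 0 of type \<open>B\<close>.\<close>

lemma weyl_B_conj_s0:
  assumes n: "3 \<le> n" and k: "1 \<le> k" "k \<le> n - 1"
  shows "weight_refl (2 * n) 0 \<circ> (weight_refl (2 * n) k \<circ> weight_refl (2 * n) (2 * n - k))
    \<circ> weight_refl (2 * n) 0 \<in> weyl_B n"
proof (cases "k = 1")
  case True
  then show ?thesis unfolding weyl_B_def by (intro generate.incl) (auto simp: o_assoc)
next
  case False
  let ?s = "weight_refl (2 * n)"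
  have m: "3 \<le> 2 * n" using n by simp
  have "(k + 1) mod (2 * n) = k + 1" "(2 * n - k + 1) mod (2 * n) = 2 * n - k + 1"
    using n k False by (auto intro!: mod_less)
  then have com: "?s 0 \<circ> ?s k = ?s k \<circ> ?s 0" "?s 0 \<circ> ?s (2 * n - k) = ?s (2 * n - k) \<circ> ?s 0"
    using n k False by (auto intro!: weight_refl_commute[OF m])
  have "?s 0 \<circ> (?s k \<circ> ?s (2 * n - k)) \<circ> ?s 0 = (?s 0 \<circ> ?s k) \<circ> (?s (2 * n - k) \<circ> ?s 0)"
    by (simp only: comp_assoc)
  also have "\<dots> = ?s k \<circ> (?s 0 \<circ> ?s 0) \<circ> ?s (2 * n - k)"
    unfolding com(1) com(2)[symmetric] by (simp only: comp_assoc)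
  also have "\<dots> = ?s k \<circ> ?s (2 * n - k)"
    using n by (simp add: weight_refl_involution[OF m])
  also have "\<dots> \<in> weyl_B n"
    unfolding weyl_B_def using k by (intro generate.incl) auto
  finally show ?thesis .
qed

section \<open>Reaching self-conjugate cores\<close>

text \<open>A box that maximizes the sum of its coordinates will do.\<close>

lemma corner_exists:
  assumes c: "is_partition c" and ne: "c \<noteq> {}"
  obtains p q where "(p, q) \<in> c" "is_partition (c - {(p, q)})"
proof -
  have "finite c" using c by (simp add: is_partition_def)
  then obtain b where b: "b \<in> c" "\<And>b'. b' \<in> c \<Longrightarrow> fst b' + snd b' \<le> fst b + snd b"
    using ne finite_imageI[of c "\<lambda>b. fst b + snd b"] Max_in[of "(\<lambda>b. fst b + snd b) ` c"]
      Max_ge[of "(\<lambda>b. fst b + snd b) ` c"] by (metis (no_types, lifting) empty_is_image imageE imageI)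
  obtain p q where pq: "b = (p, q)" by (cases b)
  have "(Suc p, q) \<notin> c" "(p, Suc q) \<notin> c" using b(2)[of "(Suc p, q)"] b(2)[of "(p, Suc q)"] pq by auto
  then show ?thesis using that b pq partition_remove_iff[OF c, of p q] by blast
qed

text \<open>The parity of the diagonal counts the letters \<open>s\<^sub>0\<close> in a word for \<open>w\<close>, and \<open>weyl_B\<close> consists of
  the elements of \<open>weyl_D\<close> with an even number of them. Correcting odd elements by one factor \<open>s\<^sub>0\<close>
  makes the statement hold for every self-conjugate core, so that it can be proved by removing
  boxes one orbit of residues at a time, which need not stay within even diagonals.\<close>

definition reachable :: "nat \<Rightarrow> diagram \<Rightarrow> bool" where
  "reachable n c \<longleftrightarrow> (\<exists>w \<in> weyl_D n. weyl_acts (2 * n) w {} c \<and>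
     (if even (depth c 0) then w else weight_refl (2 * n) 0 \<circ> w) \<in> weyl_B n)"

lemma reachable_empty: "reachable n {}"
  unfolding reachable_def weyl_D_def weyl_B_def
  by (intro bexI[of _ id]) (auto simp: depth_empty id_in_generate intro: weyl_acts.one)

lemma reachable_s0:
  assumes n: "3 \<le> n" and d: "reachable n d"
    and par: "even (depth (core_refl (2 * n) 0 d) 0) \<longleftrightarrow> odd (depth d 0)"
  shows "reachable n (core_refl (2 * n) 0 d)"
proof -
  let ?s = "weight_refl (2 * n) 0"
  obtain w where w: "w \<in> weyl_D n" "weyl_acts (2 * n) w {} d"
      "(if even (depth d 0) then w else ?s \<circ> w) \<in> weyl_B n"
    using d unfolding reachable_def by blast
  have "?s \<in> weyl_D n" unfolding weyl_D_def by (intro generate.incl) auto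
  then have "?s \<circ> w \<in> weyl_D n" using weyl_D_comp[OF n] w(1) by blast
  moreover have "weyl_acts (2 * n) (?s \<circ> w) {} (core_refl (2 * n) 0 d)"
    using w(2) n by (intro weyl_acts.refl) auto
  moreover have "?s \<circ> (?s \<circ> w) = w"
    using weight_refl_involution[of "2 * n" 0] n by (simp add: o_assoc)
  ultimately show ?thesis
    unfolding reachable_def using w(3) par by (intro bexI[of _ "?s \<circ> w"]) (auto split: if_splits)
qed

text \<open>If \<open>s\<^sub>0 w\<close> is the corrected element, the one for \<open>t w\<close> is \<open>s\<^sub>0 t w = (s\<^sub>0 t s\<^sub>0) (s\<^sub>0 w)\<close>.\<close>

lemma reachable_step:
  assumes n: "3 \<le> n" and d: "reachable n d"
    and t: "t \<in> weyl_D n" "t \<in> weyl_B n" "weight_refl (2 * n) 0 \<circ> t \<circ> weight_refl (2 * n) 0 \<in> weyl_B n"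
    and acts: "\<And>w. weyl_acts (2 * n) w {} d \<Longrightarrow> weyl_acts (2 * n) (t \<circ> w) {} e"
    and par: "depth e 0 = depth d 0"
  shows "reachable n e"
proof -
  let ?s = "weight_refl (2 * n) 0"
  obtain w where w: "w \<in> weyl_D n" "weyl_acts (2 * n) w {} d"
      "(if even (depth d 0) then w else ?s \<circ> w) \<in> weyl_B n"
    using d unfolding reachable_def by blast
  have "?s \<circ> (t \<circ> w) = (?s \<circ> t \<circ> ?s) \<circ> (?s \<circ> w)"
  proof -
    have "(?s \<circ> t \<circ> ?s) \<circ> (?s \<circ> w) = ?s \<circ> t \<circ> (?s \<circ> ?s) \<circ> w"
      by (simp only: comp_assoc)
    then show ?thesis
      using weight_refl_involution[of "2 * n" 0] n by (simp add: comp_assoc)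
  qed
  then have "(if even (depth e 0) then t \<circ> w else ?s \<circ> (t \<circ> w)) \<in> weyl_B n"
    using w(3) par t weyl_B_comp[OF n] by (auto split: if_splits)
  then show ?thesis
    unfolding reachable_def using w acts weyl_D_comp[OF n t(1)] by blast
qed

text \<open>A nonempty core has a removable box, of residue \<open>i\<close> say, and by symmetry one of residue \<open>-i\<close>.
  Removing all boxes of these two residues is the action of one generator of type \<open>D\<close>, and leaves
  a smaller self-conjugate core; the generator is an involution, so it leads back to \<open>c\<close>.\<close>

lemma self_conjugate_core_reachable:
  assumes n: "3 \<le> n"
  shows "is_partition c \<Longrightarrow> abacus_flush (2 * n) c \<Longrightarrow> conjugate c = c \<Longrightarrow> reachable n c"
proof (induction "card c" arbitrary: c rule: less_induct)
  case less
  let ?m = "2 * n" and ?r = "core_refl (2 * n)" and ?s = "weight_refl (2 * n)"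
  note c = less.prems(1,2)
  have m: "2 \<le> ?m" "0 < ?m" "3 \<le> ?m" using n by auto
  have pf: "is_partition (?r i d)" "abacus_flush ?m (?r i d)"
    if "is_partition d" "abacus_flush ?m d" for i d
    using partition_core_refl[OF that(1)] flush_core_refl[OF that m(1)] by auto
  have drop: "card (?r i d) < card d" if "is_partition d" "removable ?m i d \<noteq> {}" for i d
  proof -
    have "?r i d = d - removable ?m i d" using that unfolding core_refl_def by simp
    then have "?r i d \<subset> d" using that(2) unfolding removable_def by auto
    then show ?thesis using that(1) by (simp add: is_partition_def psubset_card_mono)
  qed
  show ?case
  proof (cases "c = {}")
    case True
    then show ?thesis by (simp add: reachable_empty)
  next
    case False
    then obtain p q where pq: "(p, q) \<in> c" "is_partition (c - {(p, q)})"
      using corner_exists[OF c(1)] by blast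
    define i where "i = residue ?m (p, q)"
    have rem: "(p, q) \<in> removable ?m i c" using pq unfolding removable_def i_def by simp
    have "int i = (int q - int p) mod int ?m"
      using residue_eq_iff[OF m(2), of p q i] unfolding i_def by simp
    then have "int i < int ?m" using m(2) by simp
    then have im: "i < ?m" by linarith
    let ?d = "?r i c"
    have lt: "card ?d < card c" using drop[OF c(1)] rem by blast
    have undo: "?r i ?d = c" by (rule core_refl_involution[OF c m(1)])
    consider "i = 0 \<or> i = n" | "i \<noteq> 0" "i \<noteq> n" by blast
    then show ?thesis
    proof cases
      case 1
      have "y mod int ?m = int i \<longleftrightarrow> (- y) mod int ?m = int i" for y
        using 1 n zmod_zminus1_eq_if[of y "int ?m"] by auto
      then have sd: "conjugate ?d = ?d"
        using conjugate_core_refl[OF c m(1), of i i] less.prems(3) by simp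
      have d: "reachable n ?d" by (rule less.hyps[OF lt pf[OF c] sd])
      show ?thesis
      proof (cases "i = 0")
        case True
        then show ?thesis
          using reachable_s0[OF n d] diagonal_parity_core_refl_0[OF pf[OF c] m(1) sd] undo by simp
      next
        case False
        then have i: "i = n" using 1 by simp
        have com: "?s 0 \<circ> ?s n = ?s n \<circ> ?s 0"
          using n by (intro weight_refl_commute[OF m(3)]) (auto simp: mod_if)
        have B: "?s n \<in> weyl_B n" unfolding weyl_B_def by (intro generate.incl) auto
        have "?s 0 \<circ> ?s n \<circ> ?s 0 = ?s n"
          using weight_refl_involution[OF m(3,2)] unfolding com by (simp add: comp_assoc)
        moreover have "?s n \<in> weyl_D n" unfolding weyl_D_def by (intro generate.incl) auto
        moreover have "weyl_acts ?m (?s n \<circ> w) {} c" if "weyl_acts ?m w {} ?d" for w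
          using weyl_acts.refl[OF that, of n] undo i n by simp
        moreover have "depth c 0 = depth ?d 0"
          using diagonal_core_refl[OF c m(1) False] by simp
        ultimately show ?thesis using B by (intro reachable_step[OF n d]) auto
      qed
    next
      case 2
      define j where "j = ?m - i"
      have j: "j < ?m" "j \<noteq> 0" "j \<noteq> i" "i = ?m - j" using 2 im unfolding j_def by auto
      have ni: "(int i + 1) mod int ?m \<noteq> int j" "(int i - 1) mod int ?m \<noteq> int j"
        "(int j + 1) mod int ?m \<noteq> int i" "(int j - 1) mod int ?m \<noteq> int i"
      proof -
        \<comment> \<open>\<open>i\<close> and \<open>j = 2n - i\<close> have the same parity, and so cannot be adjacent modulo \<open>2n\<close>.\<close>
        have "even (x mod int ?m) \<longleftrightarrow> even x" for x by (simp add: dvd_mod_iff)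
        moreover have "even j \<longleftrightarrow> even i" using im unfolding j_def by auto
        ultimately show "(int i + 1) mod int ?m \<noteq> int j" "(int i - 1) mod int ?m \<noteq> int j"
          "(int j + 1) mod int ?m \<noteq> int i" "(int j - 1) mod int ?m \<noteq> int i"
          by (metis even_of_nat even_plus_one_iff even_diff odd_one even_add)+
      qed
      have com: "?r i (?r j e) = ?r j (?r i e)" if "is_partition e" "abacus_flush ?m e" for e
        using core_refl_commute[OF that m(1)] ni j(3) by blast
      let ?e = "?r j ?d"
      have neg: "y mod int ?m = int i \<longleftrightarrow> (- y) mod int ?m = int j" for y
        using 2 im zmod_zminus1_eq_if[of y "int ?m"] unfolding j_def by auto
      have "conjugate ?d = ?r j c"
        using conjugate_core_refl[OF c m(1) neg] less.prems(3) by simp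
      moreover have "conjugate ?e = ?r i (conjugate ?d)"
        using neg by (intro conjugate_core_refl[OF pf[OF c] m(1)]) (metis minus_minus)
      ultimately have se: "conjugate ?e = ?e" using com[OF c] by simp
      have "(q, p) \<in> removable ?m j ?d"
      proof -
        have res: "residue ?m (q, p) = j"
          using residue_swap[of i ?m q p] 2 im unfolding i_def j_def by simp
        have "(q, p) \<in> c" "(Suc q, p) \<notin> c" "(q, Suc p) \<notin> c"
          using pq partition_remove_iff[OF c(1), of p q] less.prems(3) conjugate_iff by blast+
        moreover have "?d = c - removable ?m i c" using rem unfolding core_refl_def by auto
        moreover have "(q, p) \<notin> removable ?m i c" using res j(3) by (simp add: removable_def)
        ultimately have "(q, p) \<in> ?d" "(Suc q, p) \<notin> ?d" "(q, Suc p) \<notin> ?d" by blast+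
        then show ?thesis
          using partition_remove_iff[OF pf(1)[OF c], of i q p] res by (simp add: removable_def)
      qed
      then have "removable ?m j ?d \<noteq> {}" by blast
      then have "card ?e < card c" using drop[OF pf(1)[OF c]] lt less_trans by blast
      then have e: "reachable n ?e" by (rule less.hyps[OF _ pf[OF pf[OF c]] se])
      have ce: "c = ?r i (?r j ?e)" using core_refl_involution[OF pf[OF c] m(1)] undo by simp
      then have ce': "c = ?r j (?r i ?e)" using com[OF pf[OF pf[OF c]]] by simp
      \<comment> \<open>The generators of type \<open>D\<close> are listed with the smaller of the two indices.\<close>
      define k where "k = min i j"
      have k: "1 \<le> k" "k \<le> n - 1" "c = ?r k (?r (?m - k) ?e)" "k < ?m" "?m - k < ?m"
        using 2 im ce ce' unfolding k_def j_def by (auto simp: min_def)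
      have "?s k \<circ> ?s (?m - k) \<in> weyl_D n" unfolding weyl_D_def using k by (intro generate.incl) auto
      moreover have "?s k \<circ> ?s (?m - k) \<in> weyl_B n" unfolding weyl_B_def using k by (intro generate.incl) auto
      moreover note weyl_B_conj_s0[OF n k(1,2)]
      moreover have "weyl_acts ?m (?s k \<circ> ?s (?m - k) \<circ> w) {} c" if "weyl_acts ?m w {} ?e" for w
        using weyl_acts.refl[OF weyl_acts.refl[OF that k(5)] k(4)] k(3) by (simp add: comp_assoc)
      moreover have "depth c 0 = depth ?e 0"
        using diagonal_core_refl[OF c m(1)] diagonal_core_refl[OF pf[OF c] m(1)] 2 j(2) by simp
      ultimately show ?thesis by (intro reachable_step[OF n e]) auto
    qed
  qed
qed

section \<open>Expansions in the folded roots\<close>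

text \<open>The residues \<open>i\<close> and \<open>2n - i\<close> are paired by conjugation; \<open>0\<close> and \<open>n\<close> are paired with
  themselves.\<close>

lemma sum_fold:
  fixes f :: "nat \<Rightarrow> 'a::comm_monoid_add"
  assumes "1 \<le> n"
  shows "(\<Sum>j<2 * n. f j) = f 0 + f n + (\<Sum>i\<in>{1..<n}. f i + f (2 * n - i))"
proof -
  have upper: "(\<lambda>i. 2 * n - i) ` {1..<n} = {n<..<2 * n}"
  proof
    have "j \<in> (\<lambda>i. 2 * n - i) ` {1..<n}" if "n < j" "j < 2 * n" for j
      using that by (intro image_eqI[of _ _ "2 * n - j"]) auto
    then show "{n<..<2 * n} \<subseteq> (\<lambda>i. 2 * n - i) ` {1..<n}" by auto
  qed auto
  have "{..<2 * n} = insert 0 (insert n {1..<n}) \<union> (\<lambda>i. 2 * n - i) ` {1..<n}"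
    unfolding upper using assms by auto
  moreover have "sum f ((\<lambda>i. 2 * n - i) ` {1..<n}) = (\<Sum>i\<in>{1..<n}. f (2 * n - i))"
    by (subst sum.reindex) (auto simp: inj_on_def)
  moreover have "insert 0 (insert n {1..<n}) \<inter> (\<lambda>i. 2 * n - i) ` {1..<n} = {}"
    unfolding upper by auto
  then have "sum f (insert 0 (insert n {1..<n}) \<union> (\<lambda>i. 2 * n - i) ` {1..<n})
      = sum f (insert 0 (insert n {1..<n})) + sum f ((\<lambda>i. 2 * n - i) ` {1..<n})"
    by (intro sum.union_disjoint) auto
  moreover have "sum f (insert 0 (insert n {1..<n})) = f 0 + f n + sum f {1..<n}"
    using assms by (simp add: add.assoc)
  ultimately show ?thesis by (simp add: sum.distrib add.assoc)
qed

lemma sum_atMost_ends: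
  fixes f :: "nat \<Rightarrow> 'a::comm_monoid_add"
  assumes "1 \<le> n"
  shows "(\<Sum>i\<le>n. f i) = f 0 + f n + (\<Sum>i\<in>{1..<n}. f i)"
proof -
  have "{..n} = insert 0 (insert n {1..<n})" using assms by auto
  then show ?thesis using assms by (simp add: add.assoc)
qed

text \<open>The span of the roots of type \<open>D\<close> consists of the combinations of the roots of type \<open>A\<close>
  with symmetric coefficients.\<close>

lemma root_D_sum:
  assumes n: "1 \<le> n"
  shows "(\<Sum>i\<le>n. x i *\<^sub>w root_D n i) = (\<Sum>j<2 * n. x (min j (2 * n - j)) *\<^sub>w simple_root (2 * n) j)"
proof -
  have "x i *\<^sub>w root_D n i = x (min i (2 * n - i)) *\<^sub>w simple_root (2 * n) i
      + x (min (2 * n - i) (2 * n - (2 * n - i))) *\<^sub>w simple_root (2 * n) (2 * n - i)"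
    if "i \<in> {1..<n}" for i
    using that by (auto simp: root_D_def scale_def fun_eq_iff min_def algebra_simps)
  then show ?thesis
    unfolding sum_fold[OF n] sum_atMost_ends[OF n] using n by (simp add: root_D_def)
qed

text \<open>Since \<open>\<alpha>\<^sub>0\<close> of type \<open>B\<close> is \<open>2 \<alpha>\<^sub>0 + \<alpha>\<^sub>1\<close> of type \<open>D\<close>, its coefficient counts twice towards index
  0 and once towards index 1.\<close>

lemma root_B_sum:
  assumes n: "1 \<le> n"
  shows "(\<Sum>i\<le>n. b i *\<^sub>w root_B n i)
    = (\<Sum>i\<le>n. (if i = 0 then 2 * b 0 else if i = 1 then b 0 + b 1 else b i) *\<^sub>w root_D n i)"
proof -
  have "{..n} = insert 0 (insert 1 {2..n})" using n by auto
  then show ?thesis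
    by (simp add: root_B_def fun_eq_iff scale_def algebra_simps sum_weight_apply)
qed

lemma roots_D_independent:
  assumes n: "1 \<le> n" and eq: "(\<Sum>i\<le>n. x i *\<^sub>w root_D n i) = (\<Sum>i\<le>n. y i *\<^sub>w root_D n i)" and i: "i \<le> n"
  shows "x i = y i"
proof -
  have "min i (2 * n - i) = i" using i by simp
  then show ?thesis
    using simple_roots_independent[OF _ eq[unfolded root_D_sum[OF n]], of i] n i by simp
qed

lemma roots_B_independent:
  assumes n: "1 \<le> n" and eq: "(\<Sum>i\<le>n. x i *\<^sub>w root_B n i) = (\<Sum>i\<le>n. y i *\<^sub>w root_B n i)" and i: "i \<le> n"
  shows "x i = y i"
  using roots_D_independent[OF n eq[unfolded root_B_sum[OF n]], of 0]
    roots_D_independent[OF n eq[unfolded root_B_sum[OF n]], of 1]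
    roots_D_independent[OF n eq[unfolded root_B_sum[OF n]], of i] n i
  by (auto split: if_splits)

text \<open>One element of \<open>W\<close> with \<open>w \<cdot> \<emptyset> = c\<close> suffices to evaluate the description, because
  \<open>w(\<Lambda>\<^sub>0)\<close> does not depend on the choice of \<open>w\<close>.\<close>

lemma root_coeffs_eq:
  assumes m: "2 \<le> 2 * n" and w: "w \<in> W" "weyl_acts (2 * n) w {} c"
    and indep: "\<And>x y i. (\<Sum>i\<le>n. x i *\<^sub>w \<alpha> i) = (\<Sum>i\<le>n. y i *\<^sub>w \<alpha> i) \<Longrightarrow> i \<le> n \<Longrightarrow> x i = (y i :: real)"
    and a: "(\<Sum>i\<le>n. a i *\<^sub>w \<alpha> i) = (\<Sum>j<2 * n. real (num_nodes (2 * n) c j) *\<^sub>w simple_root (2 * n) j)"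
  shows "root_coeffs n W (fund 0) \<alpha> c = (\<lambda>i. if i \<le> n then a i else 0)"
  unfolding root_coeffs_def
proof (rule the_equality)
  have "(\<Sum>i\<le>n. (if i \<le> n then a i else 0) *\<^sub>w \<alpha> i) = (\<Sum>i\<le>n. a i *\<^sub>w \<alpha> i)"
    by (intro sum.cong) auto
  then show "(\<forall>i>n. (if i \<le> n then a i else 0) = 0) \<and> (\<exists>w\<in>W. weyl_acts (2 * n) w {} c
      \<and> fund 0 - w (fund 0) = (\<Sum>i\<le>n. (if i \<le> n then a i else 0) *\<^sub>w \<alpha> i))"
    using w weyl_acts_fund0[OF w(2) m] a by auto
next
  fix b
  assume b: "(\<forall>i>n. b i = 0) \<and> (\<exists>w\<in>W. weyl_acts (2 * n) w {} c
      \<and> fund 0 - w (fund 0) = (\<Sum>i\<le>n. b i *\<^sub>w \<alpha> i))"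
  then obtain v where v: "weyl_acts (2 * n) v {} c" "fund 0 - v (fund 0) = (\<Sum>i\<le>n. b i *\<^sub>w \<alpha> i)"
    by blast
  then have eq: "(\<Sum>i\<le>n. b i *\<^sub>w \<alpha> i) = (\<Sum>i\<le>n. a i *\<^sub>w \<alpha> i)"
    using weyl_acts_fund0[OF v(1) m] a by simp
  show "b = (\<lambda>i. if i \<le> n then a i else 0)"
  proof
    fix i
    show "b i = (if i \<le> n then a i else 0)"
      using b indep[OF eq, of i] by (cases "i \<le> n") simp_all
  qed
qed

lemma num_boxes_eq_sum:
  assumes c: "finite c" and m: "0 < m"
  shows "num_boxes c = (\<Sum>i<m. num_nodes m c i)"
proof -
  have "residue m b < m" for b
    using m unfolding residue_def by (simp add: nat_less_iff)
  then have "c = (\<Union>i<m. {b \<in> c. residue m b = i})" by auto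
  moreover have "card (\<Union>i<m. {b \<in> c. residue m b = i}) = (\<Sum>i<m. card {b \<in> c. residue m b = i})"
    using c by (intro card_UN_disjoint) auto
  ultimately show ?thesis unfolding num_boxes_def num_nodes_def by simp
qed

theorem proposition5p9:
  fixes n :: nat and c :: diagram
  assumes "n \<ge> 3"
    and "c \<in> even_self_conj_cores (2 * n)"
  shows "atomic_length_B n c = atomic_length_D n c - coeff_D n c 0 \<and>
    atomic_length_D n c - coeff_D n c 0 =
      1 / 2 * (real (num_boxes c) - real (num_nodes (2 * n) c 0) + real (num_nodes (2 * n) c n))"
proof -
  have n: "1 \<le> n" "2 \<le> 2 * n" using assms(1) by auto
  have core: "c \<in> cores (2 * n)" and sc: "conjugate c = c" and par: "even (card {b \<in> c. fst b = snd b})"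
    using assms(2) unfolding even_self_conj_cores_def self_conj_cores_def by auto
  have c: "is_partition c" and fin: "finite c" using core unfolding cores_def is_partition_def by auto
  have "even (depth c 0)" using par diagonal_boxes_eq_depth[OF fin] by simp
  then obtain w where w: "w \<in> weyl_D n" "w \<in> weyl_B n" "weyl_acts (2 * n) w {} c"
    using self_conjugate_core_reachable[OF assms(1) c core_flush[OF core] sc] unfolding reachable_def by auto
  define a where "a i = real (num_nodes (2 * n) c i)" for i
  have sym: "a (2 * n - i) = a i" if "0 < i" "i < 2 * n" for i
    using num_nodes_conjugate[OF that, of c] sc unfolding a_def by simp
  have expand_D: "(\<Sum>i\<le>n. a i *\<^sub>w root_D n i) = (\<Sum>j<2 * n. a j *\<^sub>w simple_root (2 * n) j)"
    unfolding root_D_sum[OF n(1)]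
  proof (rule sum.cong)
    fix j assume "j \<in> {..<2 * n}"
    then have "a (min j (2 * n - j)) = a j" using sym[of j] by (cases "j = 0") (auto simp: min_def)
    then show "a (min j (2 * n - j)) *\<^sub>w simple_root (2 * n) j = a j *\<^sub>w simple_root (2 * n) j" by simp
  qed simp
  have D: "coeff_D n c = (\<lambda>i. if i \<le> n then a i else 0)"
    unfolding coeff_D_def fund0_D_def
    using roots_D_independent[OF n(1)] expand_D unfolding a_def
    by (intro root_coeffs_eq[OF n(2) w(1,3)]) auto
  \<comment> \<open>Solving the relation between the coefficients of types \<open>B\<close> and \<open>D\<close>: the value at 0 is halved,
    and as much is taken off the coefficient at 1. Hence the total drops by the coefficient at 0.\<close>
  define b where "b i = (if i = 0 then a 0 / 2 else if i = 1 then a 1 - a 0 / 2 else a i)" for i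
  have "(\<Sum>i\<le>n. b i *\<^sub>w root_B n i) = (\<Sum>i\<le>n. a i *\<^sub>w root_D n i)"
    unfolding root_B_sum[OF n(1)] b_def by (intro sum.cong) auto
  then have B: "coeff_B n c = (\<lambda>i. if i \<le> n then b i else 0)"
    unfolding coeff_B_def fund0_B_def fund0_D_def
    using roots_B_independent[OF n(1)] expand_D unfolding a_def
    by (intro root_coeffs_eq[OF n(2) w(2,3)]) auto
  have len_D: "atomic_length_D n c - coeff_D n c 0 = a n + (\<Sum>i\<in>{1..<n}. a i)"
    unfolding atomic_length_D_def D sum_atMost_ends[OF n(1)] by simp
  have "atomic_length_B n c = (\<Sum>i\<le>n. b i)"
    unfolding atomic_length_B_def B by (intro sum.cong) auto
  also have "\<dots> = (\<Sum>i\<le>n. a i) - a 0"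
  proof -
    have "{..n} = insert 0 (insert 1 {2..n})" using n by auto
    then show ?thesis by (simp add: b_def)
  qed
  also have "\<dots> = a n + (\<Sum>i\<in>{1..<n}. a i)"
    unfolding sum_atMost_ends[OF n(1)] by simp
  finally have len_B: "atomic_length_B n c = a n + (\<Sum>i\<in>{1..<n}. a i)" .
  have "real (num_boxes c) = (\<Sum>j<2 * n. a j)"
    using num_boxes_eq_sum[OF fin, of "2 * n"] n by (simp add: a_def)
  also have "\<dots> = a 0 + a n + (\<Sum>i\<in>{1..<n}. a i + a (2 * n - i))"
    by (rule sum_fold[OF n(1)])
  also have "(\<Sum>i\<in>{1..<n}. a i + a (2 * n - i)) = (\<Sum>i\<in>{1..<n}. 2 * a i)"
    by (intro sum.cong) (auto simp: sym)
  finally have "real (num_boxes c) = a 0 + a n + 2 * (\<Sum>i\<in>{1..<n}. a i)"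
    by (simp add: sum_distrib_left)
  then show ?thesis using len_D len_B by (simp add: a_def)
qed

end
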